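(* Let $R=k[t^{a_1},\dots,t^{a_n}]$ be a numerical semigroup ring and let $F$ denote the Frobenius number of $R$. If $A$ is a minimal homogeneous presentation matrix for the conductor ideal $\mathfrak{c}_R$, then $$\operatorname{tr}_R(\Omega^1_R(\mathfrak{c}_R))=I_1(A)=\sum_{i=2}^{a_1}\operatorname{tr}_R\big((t^{F+1},t^{F+i})\big)=\sum_{i=2}^{a_1}\operatorname{tr}_R\big((t^{F+1}:t^{F+i})\big).$$
   Context: Here $k$ is a field and $a_1<\cdots<a_n$ are the minimal generators of a numerical semigroup (so $\gcd(a_1,\dots,a_n)=1$); $R\subseteq k[t]$ is graded with $t$ in degree $1$. The Frobenius number is $F=\sup\{i\in\mathbb{Z}\mid t^i\notin R\}$. $\mathfrak{c}_R=(R:_{Q(R)}\overline{R})$ is the conductor ideal, where $\overline{R}=k[t]$ is the integral closure of $R$ in its fraction field $Q(R)$; one has $\mathfrak{c}_R=(t^{F+1},\dots,t^{F+a_1})$. $(t^{F+1},t^{F+i})$ is the ideal generated by these two elements, and $(x:y)=\{r\in R\mid ry\in xR\}$. The trace ideal of an $R$-module $M$ is $\operatorname{tr}_R(M)=\langle f(x)\mid f\in\operatorname{Hom}_R(M,R),\ x\in M\rangle$. $\Omega^1_R(M)$ is the first syzygy of $M$, i.e. the kernel of a surjection from a free module onto $M$ given by a minimal homogeneous generating set. A minimal homogeneous presentation matrix of $M$ is the matrix $A$ in a minimal graded presentation $R^{\oplus q}\xrightarrow{A}R^{\oplus p}\to M\to0$, and $I_1(A)$ is the ideal generated by its entries (zero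 if $A$ has no columns). *)

theory Defs
  imports
    "Jordan_Normal_Form.VS_Connect"
    "HOL-Algebra.Generated_Rings"
    "HOL-Library.Set_Algebras"
    "HOL-Computational_Algebra.Polynomial_Factorial"
begin

section \<open>Numerical semigroups\<close>

text \<open>Finite complement is the standard form of the condition that the gcd of \<open>S\<close> is 1.\<close>

definition numerical_semigroup :: "nat set \<Rightarrow> bool" where
  "numerical_semigroup S \<longleftrightarrow>
     0 \<in> S \<and> (\<forall>x\<in>S. \<forall>y\<in>S. x + y \<in> S) \<and> finite (- S)"

definition generated_semigroup :: "nat set \<Rightarrow> nat set" where
  "generated_semigroup B = {(\<Sum>b\<in>C. m b * b) | C m. finite C \<and> C \<subseteq> B}"

definition minimal_semigroup_generators :: "nat set \<Rightarrow> nat set \<Rightarrow> bool" where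
  "minimal_semigroup_generators B S \<longleftrightarrow>
     generated_semigroup B = S \<and> (\<forall>C. C \<subset> B \<longrightarrow> generated_semigroup C \<noteq> S)"


section \<open>Numerical semigroup rings\<close>

text \<open>
  All rings and fractional ideals live inside the field \<open>k(t)\<close>, the type
  \<^typ>\<open>'k::field poly fract\<close>; in particular \<open>t\<close> may be raised to negative powers.
\<close>

definition const :: "'k::field \<Rightarrow> 'k poly fract" where
  "const c = to_fract [:c:]"

definition t :: "'k::field poly fract" where
  "t = to_fract [:0, 1:]"

definition semigroup_ring :: "nat set \<Rightarrow> 'k::field poly fract ring" where
  "semigroup_ring B =
     class_ring\<lparr>carrier := generate_ring class_ring (range const \<union> (\<lambda>b. t ^ b) ` B)\<rparr>"

text \<open>For \<open>R = k[t]\<close> the supremum is \<open>-1\<close>, since it is taken over the integers.\<close>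

definition frobenius_number :: "'k::field poly fract ring \<Rightarrow> int" where
  "frobenius_number R = Sup {i. t powi i \<notin> carrier R}"


section \<open>The conductor of a subring of a field\<close>

definition quotient_field :: "'f::field ring \<Rightarrow> 'f set" where
  "quotient_field R = {x / y | x y. x \<in> carrier R \<and> y \<in> carrier R \<and> y \<noteq> 0}"

definition integral_closure :: "'f::field ring \<Rightarrow> 'f set" where
  "integral_closure R = {x \<in> quotient_field R.
     \<exists>p. lead_coeff p = 1 \<and> (\<forall>i. poly.coeff p i \<in> carrier R) \<and> poly p x = 0}"

definition conductor :: "'f::field ring \<Rightarrow> 'f set" where
  "conductor R = {x \<in> quotient_field R. \<forall>y\<in>integral_closure R. x * y \<in> carrier R}"


section \<open>Trace ideals and colon ideals\<close>

text \<open>An ideal \<open>I\<close> of \<open>R\<close> regarded as an \<open>R\<close>-module; \<open>I = carrier R\<close> gives \<open>R\<close> itself.\<close>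

definition ideal_module :: "'f ring \<Rightarrow> 'f set \<Rightarrow> ('f, 'f) module" where
  "ideal_module R I = \<lparr>carrier = I, mult = mult R, one = one R, zero = zero R,
     add = add R, smult = mult R\<rparr>"

definition trace_ideal :: "'f ring \<Rightarrow> ('f, 'm) module \<Rightarrow> 'f set" where
  "trace_ideal R M =
     Idl\<^bsub>R\<^esub> {f x | f x. f \<in> LinearCombinations.module_hom R M (ideal_module R (carrier R)) \<and> x \<in> carrier M}"

definition colon :: "'f ring \<Rightarrow> 'f \<Rightarrow> 'f \<Rightarrow> 'f set" where
  "colon R x y = {r \<in> carrier R. r \<otimes>\<^bsub>R\<^esub> y \<in> PIdl\<^bsub>R\<^esub> x}"


section \<open>Syzygies and minimal homogeneous presentations\<close>

definition free_module :: "'f::field ring \<Rightarrow> nat \<Rightarrow> ('f, 'f vec) module" where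
  "free_module R p = module_vec TYPE('f) p
     \<lparr>carrier := {v \<in> carrier_vec p. \<forall>i<p. v $ i \<in> carrier R}\<rparr>"

text \<open>The kernel of \<open>R\<^sup>p \<rightarrow> M\<close>, \<open>v \<mapsto> \<Sum>i. v\<^sub>i g\<^sub>i\<close>, where \<open>p = length gs\<close>.\<close>

definition syzygy_module ::
    "'f::field ring \<Rightarrow> ('f, 'm) module \<Rightarrow> 'm list \<Rightarrow> ('f, 'f vec) module" where
  "syzygy_module R M gs = free_module R (length gs)
     \<lparr>carrier := {v \<in> carrier (free_module R (length gs)).
        (\<Oplus>\<^bsub>M\<^esub>i\<in>{..<length gs}. (v $ i) \<odot>\<^bsub>M\<^esub> (gs ! i)) = \<zero>\<^bsub>M\<^esub>}\<rparr>"

text \<open>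
  Generators are listed in some order, to index the basis of the free module; minimality
  is inclusion-minimality of the underlying set, which for homogeneous generators of a
  graded module agrees with having the least number of elements.
\<close>

definition minimal_generators :: "'f ring \<Rightarrow> ('f, 'm) module \<Rightarrow> 'm list \<Rightarrow> bool" where
  "minimal_generators R M gs \<longleftrightarrow>
     distinct gs \<and> set gs \<subseteq> carrier M \<and>
     LinearCombinations.module.span R M (set gs) = carrier M \<and>
     (\<forall>G. G \<subset> set gs \<longrightarrow> LinearCombinations.module.span R M G \<noteq> carrier M)"

definition homogeneous :: "'k::field poly fract \<Rightarrow> int \<Rightarrow> bool" where
  "homogeneous x d \<longleftrightarrow> (\<exists>c. x = const c * t powi d)"

text \<open>Homogeneity of degree \<open>e\<close> in \<open>R(-d\<^sub>1) \<oplus> \<dots> \<oplus> R(-d\<^sub>p)\<close>.\<close>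

definition homogeneous_vec :: "int list \<Rightarrow> 'k::field poly fract vec \<Rightarrow> int \<Rightarrow> bool" where
  "homogeneous_vec ds v e \<longleftrightarrow> (\<forall>i<dim_vec v. homogeneous (v $ i) (e - ds ! i))"

definition minimal_homogeneous_generators ::
    "'k::field poly fract ring \<Rightarrow> ('k poly fract, 'k poly fract) module
      \<Rightarrow> 'k poly fract list \<Rightarrow> int list \<Rightarrow> bool" where
  "minimal_homogeneous_generators R M gs ds \<longleftrightarrow>
     minimal_generators R M gs \<and> list_all2 homogeneous gs ds"

text \<open>
  Exactness of \<open>R\<^sup>q \<rightarrow> R\<^sup>p \<rightarrow> M \<rightarrow> 0\<close> means that the columns of the \<open>p \<times> q\<close> matrix \<open>A\<close>
  generate the syzygies of the chosen generators of \<open>M\<close>. The presentation is minimal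
  if both generating systems are.
\<close>

definition minimal_homogeneous_presentation ::
    "'k::field poly fract ring \<Rightarrow> ('k poly fract, 'k poly fract) module
      \<Rightarrow> 'k poly fract mat \<Rightarrow> bool" where
  "minimal_homogeneous_presentation R M A \<longleftrightarrow>
     (\<exists>gs ds es. minimal_homogeneous_generators R M gs ds \<and>
        dim_row A = length gs \<and>
        minimal_generators R (syzygy_module R M gs) (cols A) \<and>
        list_all2 (homogeneous_vec ds) (cols A) es)"

definition entry_ideal :: "'f ring \<Rightarrow> 'f mat \<Rightarrow> 'f set" where
  "entry_ideal R A = Idl\<^bsub>R\<^esub> (elements_mat A)"

end

theory Submission
  imports Defs
begin

text \<open>
  Write \<open>T\<close> for the numerical semigroup, viewed inside the integers, \<open>F\<close> for its largest gap and
  \<open>a\<close> for its least positive element. All the ideals in the theorem are spanned over \<open>k\<close> by powers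
  of \<open>t\<close>, and each of them turns out to be the span of the \<open>t^s\<close> for which \<open>s\<close> has a close
  neighbour: \<open>s\<close> lies in \<open>T\<close> and so does some \<open>s' \<noteq> s\<close> with \<open>\<bar>s' - s\<bar> < a\<close>. The set of these \<open>s\<close> is
  called \<open>near\<close>. The four ideals are compared with this span, never with each other.

  That the ideals are large enough is seen from explicit elements. The conductor is the span of
  the powers above \<open>t^F\<close> (\<open>conductor_R\<close>), and a minimal homogeneous generating system of it consists
  of one nonzero multiple of each of \<open>t^(F+1), \<dots>, t^(F+a)\<close> (\<open>conductor_generator_degrees\<close>). If
  \<open>s\<close> and \<open>s'\<close> are neighbours, two of these generators have degrees differing by \<open>s' - s\<close>, so there
  is a syzygy with entries \<open>t^s\<close> and a multiple of \<open>t^s'\<close>; its entries are values of coordinate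
  projections. For two generators of degrees \<open>i\<close> and \<open>i + d\<close>, and for the colon ideal, which is
  spanned by the \<open>t^s\<close> with \<open>s\<close> and \<open>s + d\<close> in \<open>T\<close>, multiplication by powers of \<open>t\<close> gives the same
  elements.

  That the ideals are not larger rests on the single gap \<open>F\<close>. Let \<open>f\<close> be a linear map from \<open>M\<close> to
  \<open>R\<close>. If \<open>t^(F-s) h\<close> still lies in \<open>M\<close>, the coefficient of \<open>t^s\<close> in \<open>f h\<close> is the coefficient of \<open>t^F\<close>
  in an element of \<open>R\<close>, hence zero (\<open>Frobenius_obstruction\<close>). Take for \<open>h\<close> a homogeneous syzygy.
  Every exponent above \<open>F\<close> belongs to \<open>T\<close>, so \<open>t^(F-s) h\<close> is again a syzygy whenever all exponents
  occurring in \<open>h\<close> exceed \<open>s\<close>. Consequently, if \<open>t^s\<close> occurs in \<open>f h\<close>, then \<open>h\<close> involves an exponent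
  \<open>u \<le> s\<close>. A single monomial is not a syzygy, so another exponent \<open>u'\<close> occurs as well, and
  \<open>0 < \<bar>u - u'\<bar> < a\<close> because the degrees of the generators lie in an interval of length \<open>a\<close>. Adding
  a multiple of \<open>a\<close> to \<open>u\<close>, or to \<open>u'\<close> if \<open>u\<close> is congruent to \<open>s\<close>, produces a close neighbour of \<open>s\<close>
  in \<open>T\<close> (\<open>near_transport\<close>). For the colon ideal the same argument applies to \<open>h = t^u\<close>, with
  \<open>u' = u + d\<close>. For the ideal generated by \<open>t^i\<close> and \<open>t^(i+d)\<close> the bound is immediate, since
  \<open>f (t^(i+d)) = t^d f (t^i)\<close> puts \<open>s\<close> and \<open>s + d\<close> into \<open>T\<close> together.
\<close>

section \<open>Coefficients of polynomials inside the field of rational functions\<close>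

lemma t_nonzero [simp]: "(t :: 'k::field poly fract) \<noteq> 0"
  by (simp add: t_def)

lemma to_fract_power: "to_fract (p ^ n) = to_fract p ^ n"
  by (induction n) simp_all

lemma t_power: "(t :: 'k::field poly fract) ^ n = to_fract (Polynomial.monom 1 n)"
  by (simp add: t_def to_fract_power [symmetric] monom_altdef)

definition polys :: "'k::field poly fract set" where
  "polys = range to_fract"

text \<open>
  Meaningful on \<^const>\<open>polys\<close> only. The index is an integer, so that multiplication by \<open>t^m\<close> shifts
  it also for negative \<open>m\<close>.
\<close>
definition coeff_at :: "'k::field poly fract \<Rightarrow> int \<Rightarrow> 'k" where
  "coeff_at x i = (if i < 0 then 0 else poly.coeff (inv_into UNIV to_fract x) (nat i))"

lemma inv_to_fract [simp]: "inv_into UNIV to_fract (to_fract (p :: 'k::field poly)) = p"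
  by (rule inv_f_f) (simp add: inj_def)

lemma coeff_at_to_fract: "coeff_at (to_fract p) i = (if i < 0 then 0 else poly.coeff p (nat i))"
  by (simp add: coeff_at_def)

lemma polysE:
  assumes "x \<in> polys" obtains p where "x = to_fract p"
  using assms by (auto simp: polys_def)

lemma polys_add: "x \<in> polys \<Longrightarrow> y \<in> polys \<Longrightarrow> x + y \<in> polys"
  and polys_mult: "x \<in> polys \<Longrightarrow> y \<in> polys \<Longrightarrow> x * y \<in> polys"
  and polys_uminus: "x \<in> polys \<Longrightarrow> - x \<in> polys"
  and polys_0: "0 \<in> polys"
  unfolding polys_def
  by (metis (no_types, lifting) imageE rangeI to_fract_add to_fract_mult to_fract_uminus to_fract_0)+

lemma coeff_at_0 [simp]: "coeff_at 0 i = 0"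
  by (metis coeff_at_to_fract to_fract_0 Polynomial.coeff_0)

lemma coeff_at_add: "x \<in> polys \<Longrightarrow> y \<in> polys \<Longrightarrow> coeff_at (x + y) i = coeff_at x i + coeff_at y i"
  by (elim polysE) (simp add: coeff_at_to_fract flip: to_fract_add)

lemma coeff_at_uminus: "x \<in> polys \<Longrightarrow> coeff_at (- x) i = - coeff_at x i"
  by (elim polysE) (simp add: coeff_at_to_fract flip: to_fract_uminus)

lemma coeff_at_diff:
  assumes "x \<in> polys" "y \<in> polys"
  shows "coeff_at (x - y) i = coeff_at x i - coeff_at y i"
  using coeff_at_add [OF assms(1) polys_uminus [OF assms(2)]] coeff_at_uminus [OF assms(2)] by simp

lemma polys_sum: "(\<And>i. i \<in> I \<Longrightarrow> f i \<in> polys) \<Longrightarrow> sum f I \<in> polys"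
  by (induction I rule: infinite_finite_induct) (auto simp: polys_0 polys_add)

lemma coeff_at_sum:
  "(\<And>i. i \<in> I \<Longrightarrow> f i \<in> polys) \<Longrightarrow> coeff_at (sum f I) j = (\<Sum>i\<in>I. coeff_at (f i) j)"
  by (induction I rule: infinite_finite_induct) (auto simp: coeff_at_add polys_sum)

lemma coeff_at_eqI:
  assumes "x \<in> polys" "y \<in> polys" "\<And>i. coeff_at x i = coeff_at y i"
  shows "x = y"
proof -
  obtain p q where pq: "x = to_fract p" "y = to_fract q" using assms(1,2) by (auto elim!: polysE)
  have "poly.coeff p n = poly.coeff q n" for n
    using assms(3) [of "int n"] by (simp add: pq coeff_at_to_fract)
  then have "p = q" by (rule poly_eqI)
  then show ?thesis by (simp add: pq)
qed

lemma coeff_at_nonneg: "coeff_at x i \<noteq> 0 \<Longrightarrow> 0 \<le> i"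
  by (auto simp: coeff_at_def split: if_splits)

lemma finite_support: "finite {i. coeff_at x i \<noteq> 0}"
proof -
  let ?p = "inv_into UNIV to_fract x"
  have "{i. coeff_at x i \<noteq> 0} \<subseteq> int ` {..Polynomial.degree ?p}"
  proof
    fix i assume "i \<in> {i. coeff_at x i \<noteq> 0}"
    then have "0 \<le> i" "poly.coeff ?p (nat i) \<noteq> 0" by (auto simp: coeff_at_def split: if_splits)
    then show "i \<in> int ` {..Polynomial.degree ?p}"
      by (intro image_eqI [of _ _ "nat i"]) (auto intro: le_degree)
  qed
  then show ?thesis by (rule finite_subset) simp
qed

lemma const_0 [simp]: "const 0 = 0"
  and const_1 [simp]: "const 1 = 1"
  and const_mult: "const (b * c) = const b * const c"
  and const_add: "const (b + c) = const b + const c"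
  by (simp_all add: const_def flip: to_fract_mult to_fract_add one_pCons)

definition mon :: "'k::field \<Rightarrow> int \<Rightarrow> 'k poly fract" where
  "mon c i = const c * t powi i"

lemma mon_mult: "mon b i * mon c j = mon (b * c) (i + j)"
  by (simp add: mon_def const_mult power_int_add)

lemma mon_add: "mon b i + mon c i = mon (b + c) i"
  by (simp add: mon_def const_add algebra_simps)

lemma mon_0 [simp]: "mon 0 i = 0"
  by (simp add: mon_def)

lemma mon_one: "mon 1 i = t powi i"
  by (simp add: mon_def)

lemma mon_nat: "mon c (int n) = to_fract (Polynomial.monom c n)"
proof -
  have "Polynomial.monom c n = [:c:] * Polynomial.monom 1 n"
    by (simp add: smult_monom)
  then have "to_fract (Polynomial.monom c n) = to_fract [:c:] * to_fract (Polynomial.monom 1 n)"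
    by (metis to_fract_mult)
  then show ?thesis by (simp add: mon_def const_def t_power)
qed

lemma mon_polys: "0 \<le> i \<Longrightarrow> mon c i \<in> polys"
  by (metis mon_nat nat_0_le polys_def rangeI)

lemma coeff_at_mon_mult_nonneg:
  assumes "x \<in> polys" "0 \<le> i"
  shows "coeff_at (mon c i * x) j = c * coeff_at x (j - i)"
proof -
  obtain p where p: "x = to_fract p" using assms(1) by (rule polysE)
  obtain n where n: "i = int n" using assms(2) by (metis nat_0_le)
  have "nat (j - int n) = nat j - n" by simp
  then show ?thesis
    by (auto simp: p n mon_nat coeff_at_to_fract coeff_monom_mult simp flip: to_fract_mult)
qed

text \<open>For negative \<open>i\<close> this is the nonnegative case read backwards, as \<open>mon c i\<close> has an inverse.\<close>
lemma coeff_at_mon_mult: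
  assumes "x \<in> polys" "mon c i * x \<in> polys"
  shows "coeff_at (mon c i * x) j = c * coeff_at x (j - i)"
proof (cases "c = 0 \<or> 0 \<le> i")
  case True
  then show ?thesis using assms by (auto simp: coeff_at_mon_mult_nonneg)
next
  case False
  have "mon (inverse c) (- i) * (mon c i * x) = mon 1 0 * x"
    using False unfolding mult.assoc [symmetric] mon_mult by simp
  then have eq: "mon (inverse c) (- i) * (mon c i * x) = x" by (simp add: mon_one)
  have "coeff_at (mon (inverse c) (- i) * (mon c i * x)) (j - i) = inverse c * coeff_at (mon c i * x) j"
    using coeff_at_mon_mult_nonneg [OF assms(2), of "- i" "inverse c" "j - i"] False by simp
  then have "coeff_at x (j - i) = inverse c * coeff_at (mon c i * x) j" unfolding eq .
  with False have "c * coeff_at x (j - i) = coeff_at (mon c i * x) j" by simp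
  then show ?thesis ..
qed

lemma coeff_at_mon: "0 \<le> i \<Longrightarrow> coeff_at (mon c i) j = (if j = i then c else 0)"
proof -
  assume "0 \<le> i"
  have "coeff_at 1 m = (if m = 0 then 1 else 0 :: 'a)" for m
    using coeff_at_to_fract [of "1 :: 'a poly" m] by (auto simp: coeff_1)
  moreover have "(1 :: 'a poly fract) \<in> polys" unfolding polys_def by (metis rangeI to_fract_1)
  ultimately show ?thesis using coeff_at_mon_mult_nonneg [of 1 i c j] \<open>0 \<le> i\<close> by simp
qed

lemma polys_expansion:
  assumes "x \<in> polys"
  shows "x = (\<Sum>i | coeff_at x i \<noteq> 0. mon (coeff_at x i) i)"
proof (rule coeff_at_eqI [OF assms])
  let ?I = "{i. coeff_at x i \<noteq> 0}"
  have P: "mon (coeff_at x i) i \<in> polys" if "i \<in> ?I" for i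
    using that by (auto intro: mon_polys coeff_at_nonneg)
  then show "(\<Sum>i\<in>?I. mon (coeff_at x i) i) \<in> polys" by (rule polys_sum)
  fix j
  have "coeff_at (\<Sum>i\<in>?I. mon (coeff_at x i) i) j = (\<Sum>i\<in>?I. coeff_at (mon (coeff_at x i) i) j)"
    using P by (rule coeff_at_sum)
  also have "\<dots> = (\<Sum>i\<in>?I. if j = i then coeff_at x i else 0)"
    by (intro sum.cong refl, subst coeff_at_mon) (auto intro: coeff_at_nonneg)
  also have "\<dots> = coeff_at x j" by (simp add: finite_support)
  finally show "coeff_at x j = coeff_at (\<Sum>i\<in>?I. mon (coeff_at x i) i) j" ..
qed

section \<open>Spans of powers of the variable\<close>

definition span_powers :: "int set \<Rightarrow> 'k::field poly fract set" where
  "span_powers A = {x \<in> polys. \<forall>i. coeff_at x i \<noteq> 0 \<longrightarrow> i \<in> A}"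

lemma span_powers_polys: "x \<in> span_powers A \<Longrightarrow> x \<in> polys"
  by (simp add: span_powers_def)

lemma span_powersD: "x \<in> span_powers A \<Longrightarrow> coeff_at x i \<noteq> 0 \<Longrightarrow> i \<in> A"
  by (simp add: span_powers_def)

lemma span_powers_mono: "A \<subseteq> B \<Longrightarrow> span_powers A \<subseteq> span_powers B"
  by (auto simp: span_powers_def)

lemma span_powers_0: "0 \<in> span_powers A"
  by (simp add: span_powers_def polys_0)

lemma span_powers_add: "x \<in> span_powers A \<Longrightarrow> y \<in> span_powers A \<Longrightarrow> x + y \<in> span_powers A"
  by (auto simp: span_powers_def polys_add coeff_at_add) (metis add_0)

lemma span_powers_uminus: "x \<in> span_powers A \<Longrightarrow> - x \<in> span_powers A"
  by (auto simp: span_powers_def polys_uminus coeff_at_uminus)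

lemma mon_in_span_powers: "i \<in> A \<Longrightarrow> 0 \<le> i \<Longrightarrow> mon c i \<in> span_powers A"
  by (auto simp: span_powers_def mon_polys coeff_at_mon split: if_splits)

lemma span_powers_induct [consumes 1, case_names zero add mon]:
  assumes "x \<in> span_powers A" "P 0" "\<And>y z. P y \<Longrightarrow> P z \<Longrightarrow> P (y + z)"
    and "\<And>c i. i \<in> A \<Longrightarrow> 0 \<le> i \<Longrightarrow> P (mon c i)"
  shows "P x"
proof -
  have "P (\<Sum>i\<in>I. mon (coeff_at x i) i)" if "I \<subseteq> {i. coeff_at x i \<noteq> 0}" for I
    using that
    by (induction I rule: infinite_finite_induct)
      (use assms(2) in simp, use assms(2) in simp,
       auto intro!: assms(3,4) span_powersD [OF assms(1)] coeff_at_nonneg [of x])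
  then show ?thesis
    using polys_expansion [of x] assms(1) span_powers_polys by (metis (no_types, lifting) subset_refl)
qed

lemma span_powers_subset:
  fixes X :: "'k::field poly fract set"
  assumes "0 \<in> X" "\<And>y z. y \<in> X \<Longrightarrow> z \<in> X \<Longrightarrow> y + z \<in> X"
    and "\<And>c i. i \<in> A \<Longrightarrow> 0 \<le> i \<Longrightarrow> mon c i \<in> X"
  shows "span_powers A \<subseteq> X"
proof
  fix x :: "'k poly fract" assume "x \<in> span_powers A"
  then show "x \<in> X" by (induction rule: span_powers_induct) (use assms in auto)
qed

lemma span_powers_mult:
  assumes "x \<in> span_powers A" "y \<in> span_powers B" and "\<And>i j. i \<in> A \<Longrightarrow> j \<in> B \<Longrightarrow> i + j \<in> C"
  shows "x * y \<in> span_powers C"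
  using assms(1)
proof (induction rule: span_powers_induct)
  case (mon c i)
  from assms(2) show ?case
  proof (induction rule: span_powers_induct)
    case (mon d j)
    with \<open>i \<in> A\<close> \<open>0 \<le> i\<close> show ?case by (simp add: mon_mult mon_in_span_powers assms(3))
  qed (simp_all add: span_powers_0 distrib_left span_powers_add)
qed (simp_all add: span_powers_0 distrib_right span_powers_add)

lemma sum_mon: "(\<Sum>i\<in>I. mon (f i) j) = mon (\<Sum>i\<in>I. f i) j"
  by (induction I rule: infinite_finite_induct) (simp_all add: mon_add)

lemma mon_in_span_powersD:
  fixes c :: "'k::field"
  assumes "mon c i \<in> span_powers A" "c \<noteq> 0"
  shows "i \<in> A" "0 \<le> i"
proof -
  have "(1 :: 'k poly fract) = mon 1 0" by (simp add: mon_one)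
  then have "coeff_at (mon c i * 1) i = c * coeff_at (mon 1 0) (i - i)"
    using coeff_at_mon_mult [of "1 :: 'k poly fract" c i i] assms(1) span_powers_polys
    by (metis mon_polys mult.right_neutral order_refl)
  then have "coeff_at (mon c i) i \<noteq> 0" using assms(2) by (simp add: coeff_at_mon)
  then show "i \<in> A" "0 \<le> i" using assms(1) by (auto dest: span_powersD coeff_at_nonneg)
qed

section \<open>Ideals and linear forms over a numerical semigroup ring\<close>

text \<open>
  The semigroup is a set of integers because degrees are subtracted throughout. The
  assumptions on \<open>F\<close> and \<open>a\<close> determine them as Frobenius number and multiplicity.
\<close>
locale numerical_semigroup_ring =
  fixes T :: "int set" and F a :: int and R :: "'k::field poly fract ring"
  assumes zero_in_T: "0 \<in> T"
    and T_add: "i \<in> T \<Longrightarrow> j \<in> T \<Longrightarrow> i + j \<in> T"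
    and T_nonneg: "i \<in> T \<Longrightarrow> 0 \<le> i"
    and F_notin_T: "F \<notin> T"
    and beyond_F: "F < i \<Longrightarrow> i \<in> T"
    and a_in_T: "a \<in> T"
    and a_pos: "0 < a"
    and a_least: "i \<in> T \<Longrightarrow> 0 < i \<Longrightarrow> a \<le> i"
    and R_eq: "R = class_ring\<lparr>carrier := span_powers T\<rparr>"
begin

lemma R_simps [simp]:
  "carrier R = span_powers T" "mult R = (*)" "add R = (+)" "one R = 1" "zero R = 0"
  by (simp_all add: R_eq)

lemma mon_in_R: "i \<in> T \<Longrightarrow> mon c i \<in> span_powers T"
  by (simp add: mon_in_span_powers T_nonneg)

lemma one_in_R: "1 \<in> span_powers T"
  using mon_in_R [OF zero_in_T, of 1] by (simp add: mon_one)

lemma mult_in_R: "x \<in> span_powers T \<Longrightarrow> y \<in> span_powers T \<Longrightarrow> x * y \<in> span_powers T"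
  by (rule span_powers_mult) (auto intro: T_add)

sublocale R: cring R
  by (intro cringI abelian_groupI comm_monoidI)
    (auto simp: span_powers_add span_powers_0 one_in_R mult_in_R algebra_simps
      intro: bexI [of _ "- x" for x] span_powers_uminus)

lemma a_inv_R: "x \<in> span_powers T \<Longrightarrow> \<ominus>\<^bsub>R\<^esub> x = - x"
  by (rule R.minus_equality) (auto intro: span_powers_uminus)

lemma ideal_criterion:
  assumes "I \<subseteq> span_powers T" "0 \<in> I" "\<And>x y. x \<in> I \<Longrightarrow> y \<in> I \<Longrightarrow> x + y \<in> I"
    and "\<And>r x. r \<in> span_powers T \<Longrightarrow> x \<in> I \<Longrightarrow> r * x \<in> I"
  shows "ideal I R"
proof (rule idealI)
  show "subgroup I (add_monoid R)"
  proof
    fix x assume "x \<in> I"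
    then have "(- 1) * x \<in> I" by (intro assms(4) span_powers_uminus one_in_R)
    then show "inv\<^bsub>add_monoid R\<^esub> x \<in> I"
      using a_inv_R [of x] \<open>x \<in> I\<close> assms(1) by (auto simp: a_inv_def)
  qed (use assms in auto)
next
  fix x r assume "x \<in> I" "r \<in> carrier R"
  then show "r \<otimes>\<^bsub>R\<^esub> x \<in> I" "x \<otimes>\<^bsub>R\<^esub> r \<in> I"
    using assms(4) [of r x] by (simp_all add: mult.commute)
qed (rule R.ring_axioms)

lemma ideal_closed:
  assumes "ideal I R"
  shows "I \<subseteq> span_powers T" "0 \<in> I" "x \<in> I \<Longrightarrow> y \<in> I \<Longrightarrow> x + y \<in> I"
    and "r \<in> span_powers T \<Longrightarrow> x \<in> I \<Longrightarrow> r * x \<in> I"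
proof -
  interpret ideal I R by fact
  show "I \<subseteq> span_powers T" using a_subset by simp
  show "0 \<in> I" using additive_subgroup.zero_closed [OF is_additive_subgroup] by simp
  show "x \<in> I \<Longrightarrow> y \<in> I \<Longrightarrow> x + y \<in> I"
    using additive_subgroup.a_closed [OF is_additive_subgroup] by simp
  show "r \<in> span_powers T \<Longrightarrow> x \<in> I \<Longrightarrow> r * x \<in> I" using I_l_closed [of x r] by simp
qed

lemma ideal_span_powers:
  assumes "A \<subseteq> T" "\<And>i j. i \<in> T \<Longrightarrow> j \<in> A \<Longrightarrow> i + j \<in> A"
  shows "ideal (span_powers A) R"
  using assms by (intro ideal_criterion span_powers_mono)
    (auto simp: span_powers_0 span_powers_add intro: span_powers_mult)

lemma ideal_module_simps [simp]:
  "carrier (ideal_module R I) = I" "add (ideal_module R I) = (+)" "zero (ideal_module R I) = 0"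
  "smult (ideal_module R I) = (*)"
  by (simp_all add: ideal_module_def)

lemma module_ideal_module:
  assumes "ideal I R"
  shows "Module.module R (ideal_module R I)"
proof (rule module_criteria)
  note closed = ideal_closed [OF assms]
  show "\<forall>v\<in>carrier (ideal_module R I). \<exists>w\<in>carrier (ideal_module R I).
      v \<oplus>\<^bsub>ideal_module R I\<^esub> w = \<zero>\<^bsub>ideal_module R I\<^esub>"
  proof
    fix v assume "v \<in> carrier (ideal_module R I)"
    then have "(- 1) * v \<in> I" by (intro closed span_powers_uminus one_in_R) simp
    then show "\<exists>w\<in>carrier (ideal_module R I). v \<oplus>\<^bsub>ideal_module R I\<^esub> w = \<zero>\<^bsub>ideal_module R I\<^esub>"
      by (intro bexI [of _ "- v"]) auto
  qed
qed (use ideal_closed [OF assms] in \<open>auto simp: R.is_cring algebra_simps\<close>)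

abbreviation functionals :: "('k poly fract, 'm) module \<Rightarrow> ('m \<Rightarrow> 'k poly fract) set" where
  "functionals M \<equiv> LinearCombinations.module_hom R M (ideal_module R (span_powers T))"

lemma functionalI:
  assumes "\<And>x. x \<in> carrier M \<Longrightarrow> f x \<in> span_powers T"
    and "\<And>x y. x \<in> carrier M \<Longrightarrow> y \<in> carrier M \<Longrightarrow> f (x \<oplus>\<^bsub>M\<^esub> y) = f x + f y"
    and "\<And>r x. r \<in> span_powers T \<Longrightarrow> x \<in> carrier M \<Longrightarrow> f (r \<odot>\<^bsub>M\<^esub> x) = r * f x"
  shows "f \<in> functionals M"
  using assms by (auto simp: LinearCombinations.module_hom_def)

lemma functionalD:
  assumes "f \<in> functionals M"
  shows "x \<in> carrier M \<Longrightarrow> f x \<in> span_powers T"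
    and "x \<in> carrier M \<Longrightarrow> y \<in> carrier M \<Longrightarrow> f (x \<oplus>\<^bsub>M\<^esub> y) = f x + f y"
    and "r \<in> span_powers T \<Longrightarrow> x \<in> carrier M \<Longrightarrow> f (r \<odot>\<^bsub>M\<^esub> x) = r * f x"
  using assms by (auto simp: LinearCombinations.module_hom_def)

lemma ideal_trace_ideal: "ideal (trace_ideal R M) R"
  unfolding trace_ideal_def by (rule R.genideal_ideal) (auto dest: functionalD(1))

lemma trace_idealI: "f \<in> functionals M \<Longrightarrow> x \<in> carrier M \<Longrightarrow> f x \<in> trace_ideal R M"
  unfolding trace_ideal_def
  by (rule subsetD [OF R.genideal_self]) (auto dest: functionalD(1))

lemma trace_ideal_subset:
  assumes "ideal J R" "\<And>f x. f \<in> functionals M \<Longrightarrow> x \<in> carrier M \<Longrightarrow> f x \<in> J"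
  shows "trace_ideal R M \<subseteq> J"
  unfolding trace_ideal_def using assms by (intro R.genideal_minimal) auto

text \<open>
  The hypothesis \<open>shift\<close> says that \<open>z\<close> is \<open>t^(F-s) x\<close>; since \<open>F - s\<close> may be negative, both sides are
  multiplied by a power \<open>t^N\<close>. Linearity turns the coefficient of \<open>t^s\<close> in \<open>f x\<close> into that of \<open>t^F\<close> in
  \<open>f z\<close>, and \<open>F\<close> is a gap.
\<close>
lemma Frobenius_obstruction:
  assumes f: "f \<in> functionals M" and x: "x \<in> carrier M" and z: "z \<in> carrier M"
    and "N \<in> T" "N + (F - s) \<in> T"
    and shift: "mon 1 N \<odot>\<^bsub>M\<^esub> z = mon 1 (N + (F - s)) \<odot>\<^bsub>M\<^esub> x"
  shows "coeff_at (f x) s = 0"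
proof -
  have "mon 1 N * f z = mon 1 (N + (F - s)) * f x"
    using functionalD(3) [OF f mon_in_R z] functionalD(3) [OF f mon_in_R x] assms by metis
  moreover have "coeff_at (mon 1 N * f z) (N + F) = coeff_at (f z) F"
    using assms functionalD(1) [OF f z] span_powers_polys
    by (subst coeff_at_mon_mult_nonneg) (auto intro: T_nonneg)
  moreover have "coeff_at (mon 1 (N + (F - s)) * f x) (N + F) = coeff_at (f x) s"
    using assms functionalD(1) [OF f x] span_powers_polys T_nonneg
    by (subst coeff_at_mon_mult_nonneg) auto
  ultimately have "coeff_at (f x) s = coeff_at (f z) F" by simp
  then show ?thesis using F_notin_T span_powersD [OF functionalD(1) [OF f z]] by metis
qed

section \<open>Semigroup elements with a close neighbour\<close>

lemma T_add_mult_a: "i \<in> T \<Longrightarrow> i + int k * a \<in> T"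
proof (induction k)
  case (Suc k)
  then have "(i + int k * a) + a \<in> T" using T_add a_in_T by blast
  then show ?case by (simp add: algebra_simps)
qed simp

text \<open>The exponents of the common value of all ideals in the theorem.\<close>
definition near :: "int set" where
  "near = {s \<in> T. \<exists>s'\<in>T. s' \<noteq> s \<and> \<bar>s' - s\<bar> < a}"

lemma nearI: "s \<in> T \<Longrightarrow> s' \<in> T \<Longrightarrow> s' \<noteq> s \<Longrightarrow> \<bar>s' - s\<bar> < a \<Longrightarrow> s \<in> near"
  by (auto simp: near_def)

lemma near_subset_T: "near \<subseteq> T"
  by (auto simp: near_def)

text \<open>
  Let \<open>r\<close> be the remainder of \<open>s - u\<close> modulo \<open>a\<close>. If it is positive, moving \<open>u\<close> up by multiples of \<open>a\<close>
  reaches \<open>s - r\<close>. If it is zero, the same translation takes \<open>u\<close> to \<open>s\<close>, and so \<open>u'\<close> to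
  \<open>s + (u' - u)\<close>.
\<close>
lemma near_transport:
  assumes "u \<in> T" "u' \<in> T" "u' \<noteq> u" "\<bar>u' - u\<bar> < a" "s \<in> T" "u \<le> s"
  shows "s \<in> near"
proof -
  define k where "k = nat ((s - u) div a)"
  define r where "r = (s - u) mod a"
  have r: "0 \<le> r" "r < a" using a_pos by (simp_all add: r_def)
  have "int k = (s - u) div a" using assms(6) a_pos by (simp add: k_def pos_imp_zdiv_nonneg_iff)
  then have s: "s = u + int k * a + r" by (simp add: r_def)
  show ?thesis
  proof (cases "r = 0")
    case True
    show ?thesis
      by (rule nearI [OF \<open>s \<in> T\<close> T_add_mult_a [OF assms(2), of k]]) (use s True assms in auto)
  next
    case False
    show ?thesis
      by (rule nearI [OF \<open>s \<in> T\<close> T_add_mult_a [OF assms(1), of k]]) (use s False r in auto)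
  qed
qed

text \<open>Neighbours stay neighbours when both are translated by an element of \<open>T\<close>.\<close>
lemma ideal_near: "ideal (span_powers near) R"
proof (rule ideal_span_powers)
  fix i j assume "i \<in> T" "j \<in> near"
  then obtain j' where "j \<in> T" "j' \<in> T" "j' \<noteq> j" "\<bar>j' - j\<bar> < a" by (auto simp: near_def)
  with \<open>i \<in> T\<close> show "i + j \<in> near" by (intro nearI [of _ "i + j'"] T_add) auto
qed (rule near_subset_T)

section \<open>Traces of colon ideals and of ideals with two generators\<close>

text \<open>The exponents of the monomials in the ideal of all \<open>x\<close> in \<open>R\<close> with \<open>t^d x\<close> in \<open>R\<close>.\<close>
definition shifts :: "int \<Rightarrow> int set" where
  "shifts d = {s \<in> T. s + d \<in> T}"

lemma colon_conv:
  assumes "i \<in> T" "i + d \<in> T"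
  shows "colon R (t powi i) (t powi (i + d)) = span_powers (shifts d)"
proof
  have PIdl: "PIdl\<^bsub>R\<^esub> (t powi i) = {r * t powi i | r. r \<in> span_powers T}"
    by (auto simp: cgenideal_def)
  show "span_powers (shifts d) \<subseteq> colon R (t powi i) (t powi (i + d))"
  proof (rule span_powers_subset)
    fix c :: 'k and s assume "s \<in> shifts d"
    then have "mon c s \<in> span_powers T" "mon c (s + d) \<in> span_powers T"
      by (auto simp: shifts_def mon_in_R)
    moreover have "mon c s * t powi (i + d) = mon c (s + d) * t powi i"
      by (simp add: mon_mult algebra_simps flip: mon_one)
    ultimately show "mon c s \<in> colon R (t powi i) (t powi (i + d))"
      by (auto simp: colon_def PIdl)
  next
    fix x y :: "'k poly fract" assume "x \<in> colon R (t powi i) (t powi (i + d))" "y \<in> colon R (t powi i) (t powi (i + d))"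
    then show "x + y \<in> colon R (t powi i) (t powi (i + d))"
      unfolding colon_def PIdl
      by (auto simp: span_powers_add algebra_simps) (metis distrib_right span_powers_add)
  qed (auto simp: colon_def PIdl span_powers_0 intro!: exI [of _ 0])
  show "colon R (t powi i) (t powi (i + d)) \<subseteq> span_powers (shifts d)"
  proof
    fix x assume "x \<in> colon R (t powi i) (t powi (i + d))"
    then obtain r where x: "x \<in> span_powers T" and r: "r \<in> span_powers T"
      and "x * t powi (i + d) = r * t powi i"
      by (auto simp: colon_def PIdl)
    then have eq: "r = mon 1 d * x" by (simp add: mon_one power_int_add mult.commute)
    have "s + d \<in> T" if "coeff_at x s \<noteq> 0" for s
    proof -
      have "coeff_at r (s + d) = coeff_at x s"
        using coeff_at_mon_mult [of x 1 d "s + d"] span_powers_polys [OF x] span_powers_polys [OF r]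
        by (simp add: eq)
      then show ?thesis using span_powersD [OF r, of "s + d"] that by simp
    qed
    with x show "x \<in> span_powers (shifts d)"
      by (auto simp: span_powers_def shifts_def)
  qed
qed

text \<open>The two cases are a neighbour above and a neighbour below \<open>s\<close>.\<close>
lemma near_shifts:
  assumes "s \<in> near"
  obtains d where "0 < d" "d < a" "s \<in> shifts d" | d where "0 < d" "d < a" "s - d \<in> shifts d"
proof -
  obtain s' where s': "s \<in> T" "s' \<in> T" "s' \<noteq> s" "\<bar>s' - s\<bar> < a"
    using assms by (auto simp: near_def)
  then show thesis
    using that(1) [of "s' - s"] that(2) [of "s - s'"] by (cases "s < s'") (auto simp: shifts_def)
qed

lemma ideal_shifts: "ideal (span_powers (shifts d)) R"
proof (rule ideal_span_powers)
  fix i j assume "i \<in> T" "j \<in> shifts d"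
  then show "i + j \<in> shifts d" by (auto simp: shifts_def add.assoc intro: T_add)
qed (auto simp: shifts_def)

text \<open>
  It suffices to evaluate linear forms at the monomials \<open>t^u\<close>. An exponent \<open>s < u\<close> in the value is
  excluded by the gap \<open>F\<close>: the shifted monomial has degree \<open>u + F - s > F\<close>, so it stays in the
  ideal. For \<open>s \<ge> u\<close> the pair \<open>u\<close>, \<open>u + d\<close> is transported to \<open>s\<close>.
\<close>
lemma trace_colon_subset:
  assumes "0 < d" "d < a"
  shows "trace_ideal R (ideal_module R (span_powers (shifts d))) \<subseteq> span_powers near"
proof (rule trace_ideal_subset [OF ideal_near])
  let ?M = "ideal_module R (span_powers (shifts d)) :: ('k poly fract, 'k poly fract) module"
  fix f x assume f: "f \<in> functionals ?M" and "x \<in> carrier ?M"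
  then have "x \<in> span_powers (shifts d)" by simp
  from \<open>x \<in> span_powers (shifts d)\<close> have "x \<in> carrier ?M \<and> f x \<in> span_powers near"
  proof (induction rule: span_powers_induct)
    case zero
    have "f 0 = f (0 \<odot>\<^bsub>?M\<^esub> 0)" by simp
    also have "\<dots> = 0" using functionalD(3) [OF f, of 0 0] by (simp add: span_powers_0)
    finally show ?case by (simp add: span_powers_0)
  next
    case (add y z)
    then show ?case using functionalD(2) [OF f, of y z] by (simp add: span_powers_add)
  next
    case (mon c u)
    then have u: "u \<in> T" "u + d \<in> T" by (auto simp: shifts_def)
    have inM: "mon c u \<in> carrier ?M" using mon by (simp add: mon_in_span_powers)
    have "s \<in> near" if "coeff_at (f (mon c u)) s \<noteq> 0" for s
    proof -
      have s: "s \<in> T" using functionalD(1) [OF f inM] that by (rule span_powersD)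
      have "u \<le> s"
      proof (rule ccontr)
        assume "\<not> u \<le> s"
        then have "F < u + (F - s)" by simp
        then have "mon c (u + (F - s)) \<in> carrier ?M"
          using \<open>0 < d\<close> by (simp add: mon_in_span_powers shifts_def beyond_F T_nonneg)
        \<comment> \<open>\<open>N\<close> is large enough for both \<open>N\<close> and \<open>N + F - s\<close> to exceed \<open>F\<close>.\<close>
        moreover define N where "N = \<bar>F\<bar> + \<bar>s\<bar> + 1"
        moreover have "N \<in> T" "N + (F - s) \<in> T" by (auto simp: N_def intro!: beyond_F)
        moreover have "mon 1 N \<odot>\<^bsub>?M\<^esub> mon c (u + (F - s)) = mon 1 (N + (F - s)) \<odot>\<^bsub>?M\<^esub> mon c u"
          by (simp add: mon_mult algebra_simps)
        ultimately show False using Frobenius_obstruction [OF f inM] that by blast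
      qed
      with u s assms show ?thesis by (intro near_transport [of u "u + d"]) auto
    qed
    then have "f (mon c u) \<in> span_powers near"
      using functionalD(1) [OF f inM] by (simp add: span_powers_def)
    with inM show ?case ..
  qed
  then show "f x \<in> span_powers near" ..
qed

lemma functional_mult:
  assumes "\<And>x. x \<in> I \<Longrightarrow> w * x \<in> span_powers T"
  shows "(*) w \<in> functionals (ideal_module R I)"
  using assms by (intro functionalI) (simp_all add: algebra_simps)

lemma span_powers_subset_ideal:
  assumes "ideal I R" "\<And>i. i \<in> A \<Longrightarrow> t powi i \<in> I"
  shows "span_powers A \<subseteq> I"
proof (rule span_powers_subset)
  fix c i assume "i \<in> A"
  then have "mon c 0 * t powi i \<in> I"
    by (intro ideal_closed(4) [OF assms(1)] assms(2) mon_in_R zero_in_T)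
  then show "mon c i \<in> I" by (simp add: mon_def)
qed (use ideal_closed [OF assms(1)] in auto)

text \<open>The inclusion and the multiplication by \<open>t^d\<close> are linear forms on the colon ideal.\<close>
lemma trace_colon_superset:
  assumes "s \<in> shifts d"
  shows "t powi s \<in> trace_ideal R (ideal_module R (span_powers (shifts d)))" (is "_ \<in> trace_ideal R ?M")
    and "t powi (s + d) \<in> trace_ideal R (ideal_module R (span_powers (shifts d)))"
proof -
  have s: "t powi s \<in> carrier ?M"
    using assms T_nonneg by (auto simp: shifts_def simp flip: mon_one intro!: mon_in_span_powers)
  have "(*) 1 \<in> functionals ?M"
    using ideal_closed(1) [OF ideal_shifts] by (intro functional_mult) auto
  from trace_idealI [OF this s] show "t powi s \<in> trace_ideal R ?M" by simp
  have "(*) (t powi d) \<in> functionals ?M"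
  proof (rule functional_mult)
    fix x :: "'k poly fract" assume "x \<in> span_powers (shifts d)"
    then show "t powi d * x \<in> span_powers T"
    proof (induction rule: span_powers_induct)
      case (mon c i)
      then show ?case by (simp add: mon_mult shifts_def mon_in_R add.commute flip: mon_one)
    qed (simp_all add: span_powers_0 span_powers_add algebra_simps)
  qed
  from trace_idealI [OF this s] show "t powi (s + d) \<in> trace_ideal R ?M"
    by (simp add: power_int_add mult.commute)
qed

text \<open>
  A linear form \<open>f\<close> satisfies \<open>f (t^(i+d)) = t^d f (t^i)\<close>. So every exponent \<open>s\<close> of \<open>f (t^i)\<close> is
  accompanied by the exponent \<open>s + d\<close> of \<open>f (t^(i+d))\<close>, and both are in \<open>T\<close>.
\<close>
lemma trace_two_generated_subset:
  assumes "i \<in> T" "i + d \<in> T" "0 < d" "d < a"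
  shows "trace_ideal R (ideal_module R (Idl\<^bsub>R\<^esub> {t powi i, t powi (i + d)})) \<subseteq> span_powers near"
proof (rule trace_ideal_subset [OF ideal_near])
  define I where "I = Idl\<^bsub>R\<^esub> {t powi i, t powi (i + d)}"
  have gens: "{t powi i, t powi (i + d)} \<subseteq> carrier R"
    using assms by (auto simp: mon_in_R simp flip: mon_one)
  have I: "ideal I R" unfolding I_def by (rule R.genideal_ideal [OF gens])
  have mem: "t powi i \<in> I" "t powi (i + d) \<in> I"
    using R.genideal_self [OF gens] by (auto simp: I_def)
  fix f x assume "f \<in> functionals (ideal_module R (Idl\<^bsub>R\<^esub> {t powi i, t powi (i + d)}))"
    and "x \<in> carrier (ideal_module R (Idl\<^bsub>R\<^esub> {t powi i, t powi (i + d)}))"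
  then have f: "f \<in> functionals (ideal_module R I)" and x: "x \<in> I" by (simp_all add: I_def)
  have f_R: "f y \<in> span_powers T" if "y \<in> I" for y using functionalD(1) [OF f] that by simp
  have f_mult: "f (r * y) = r * f y" if "r \<in> span_powers T" "y \<in> I" for r y
    using functionalD(3) [OF f] that by simp
  have "t powi i * f (t powi (i + d)) = t powi (i + d) * f (t powi i)"
    using f_mult [OF _ mem(1), of "t powi (i + d)"] f_mult [OF _ mem(2), of "t powi i"] gens
    by (simp add: mult.commute)
  then have eq: "f (t powi (i + d)) = mon 1 d * f (t powi i)"
    by (simp add: mon_one power_int_add)
  have coeff: "coeff_at (f (t powi (i + d))) j = coeff_at (f (t powi i)) (j - d)" for j
    using coeff_at_mon_mult [of "f (t powi i)" 1 d j] f_R mem span_powers_polys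
    by (auto simp flip: eq)
  have in_T: "s \<in> T" "s + d \<in> T" if "coeff_at (f (t powi i)) s \<noteq> 0" for s
    using that span_powersD [OF f_R [OF mem(1)]] span_powersD [OF f_R [OF mem(2)], of "s + d"]
    by (auto simp: coeff)
  have "s \<in> near" "s + d \<in> near" if "coeff_at (f (t powi i)) s \<noteq> 0" for s
    using nearI [OF in_T [OF that]] nearI [OF in_T(2) [OF that] in_T(1) [OF that]] assms by auto
  note near = this
  have "f (t powi i) \<in> span_powers near"
    using span_powers_polys [OF f_R [OF mem(1)]]
    by (auto simp: span_powers_def near(1))
  moreover have "f (t powi (i + d)) \<in> span_powers near"
    using near(2) [of "_ - d"] span_powers_polys [OF f_R [OF mem(2)]]
    by (auto simp: span_powers_def coeff)
  moreover have "ideal {y \<in> I. f y \<in> span_powers near} R"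
  proof (rule ideal_criterion)
    note closed = ideal_closed [OF I] ideal_closed [OF ideal_near]
    show "{y \<in> I. f y \<in> span_powers near} \<subseteq> span_powers T" using closed by auto
    show "0 \<in> {y \<in> I. f y \<in> span_powers near}"
      using closed f_mult [of 0 0] by (simp add: span_powers_0)
    fix y z :: "'k poly fract" assume "y \<in> {y \<in> I. f y \<in> span_powers near}" "z \<in> {y \<in> I. f y \<in> span_powers near}"
    then show "y + z \<in> {y \<in> I. f y \<in> span_powers near}"
      using closed functionalD(2) [OF f, of y z] by auto
  next
    note closed = ideal_closed [OF I] ideal_closed [OF ideal_near]
    fix r y :: "'k poly fract" assume "r \<in> span_powers T" "y \<in> {y \<in> I. f y \<in> span_powers near}"
    then show "r * y \<in> {y \<in> I. f y \<in> span_powers near}"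
      using closed f_mult by auto
  qed
  ultimately have "I \<subseteq> {y \<in> I. f y \<in> span_powers near}"
    using mem by (subst (1) I_def) (intro R.genideal_minimal, auto)
  with x show "f x \<in> span_powers near" by auto
qed

text \<open>Multiplication by \<open>t^(s-i)\<close> maps the generators to \<open>t^s\<close> and \<open>t^(s+d)\<close>.\<close>
lemma trace_two_generated_superset:
  assumes "i \<in> T" "i + d \<in> T" "s \<in> shifts d"
  shows "t powi s \<in> trace_ideal R (ideal_module R (Idl\<^bsub>R\<^esub> {t powi i, t powi (i + d)}))" (is "_ \<in> trace_ideal R (ideal_module R ?I)")
    and "t powi (s + d) \<in> trace_ideal R (ideal_module R (Idl\<^bsub>R\<^esub> {t powi i, t powi (i + d)}))"
proof -
  have gens: "{t powi i, t powi (i + d)} \<subseteq> carrier R"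
    using assms by (auto simp: mon_in_R simp flip: mon_one)
  have mem: "t powi i \<in> ?I" "t powi (i + d) \<in> ?I"
    using R.genideal_self [OF gens] by auto
  have closed: "ideal {y :: 'k poly fract. y \<in> span_powers T \<and> t powi (s - i) * y \<in> span_powers T} R"
  proof (rule ideal_criterion)
    fix r y :: "'k poly fract" assume "r \<in> span_powers T" "y \<in> {y. y \<in> span_powers T \<and> t powi (s - i) * y \<in> span_powers T}"
    then show "r * y \<in> {y. y \<in> span_powers T \<and> t powi (s - i) * y \<in> span_powers T}"
      using mult_in_R [of r "t powi (s - i) * y"] mult_in_R [of r y] by (simp add: mult.left_commute)
  qed (auto simp: span_powers_0 span_powers_add algebra_simps)
  have "t powi (s - i) * y \<in> span_powers T" if "y \<in> ?I" for y
  proof -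
    have "?I \<subseteq> {y. y \<in> span_powers T \<and> t powi (s - i) * y \<in> span_powers T}"
      using gens assms
      by (intro R.genideal_minimal closed) (auto simp: mon_mult shifts_def mon_in_R algebra_simps simp flip: mon_one)
    with that show ?thesis by auto
  qed
  then have f: "(*) (t powi (s - i)) \<in> functionals (ideal_module R ?I)"
    by (rule functional_mult)
  have "t powi (s - i) * t powi i = t powi s" "t powi (s - i) * t powi (i + d) = t powi (s + d)"
    by (simp_all flip: power_int_add)
  moreover have "t powi (s - i) * t powi i \<in> trace_ideal R (ideal_module R ?I)"
    "t powi (s - i) * t powi (i + d) \<in> trace_ideal R (ideal_module R ?I)"
    using trace_idealI [OF f, of "t powi i"] trace_idealI [OF f, of "t powi (i + d)"] mem by auto
  ultimately show "t powi s \<in> trace_ideal R (ideal_module R ?I)" "t powi (s + d) \<in> trace_ideal R (ideal_module R ?I)"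
    by metis+
qed

section \<open>Sums of ideals\<close>

text \<open>The elementwise sum of finitely many ideals is their supremum among the ideals.\<close>
lemma sum_of_ideals:
  assumes "finite D" "\<And>d. d \<in> D \<Longrightarrow> ideal (I d) R"
  shows "ideal (\<Sum>d\<in>D. I d) R \<and> (\<forall>d\<in>D. I d \<subseteq> (\<Sum>d\<in>D. I d)) \<and>
    (\<forall>J. ideal J R \<longrightarrow> (\<forall>d\<in>D. I d \<subseteq> J) \<longrightarrow> (\<Sum>d\<in>D. I d) \<subseteq> J)"
  using assms
proof (induction D rule: finite_induct)
  case empty
  have "ideal {0} R" by (rule ideal_criterion) (auto simp: span_powers_0)
  then show ?case using ideal_closed(2) by auto
next
  case (insert d D)
  let ?S = "\<Sum>d\<in>D. I d"
  have Id: "ideal (I d) R" and S: "ideal ?S R" using insert by auto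
  note closed = ideal_closed [OF Id] ideal_closed [OF S]
  have eq: "(\<Sum>d\<in>insert d D. I d) = I d + ?S" using insert by simp
  have "ideal (I d + ?S) R"
  proof (rule ideal_criterion)
    show "I d + ?S \<subseteq> span_powers T"
      using closed by (auto simp: set_plus_def intro!: span_powers_add)
    show "0 \<in> I d + ?S" using closed set_plus_intro [of 0 "I d" 0 ?S] by simp
    fix x y :: "'k poly fract" assume "x \<in> I d + ?S" "y \<in> I d + ?S"
    then obtain x1 x2 y1 y2 where "x = x1 + x2" "y = y1 + y2" "x1 \<in> I d" "y1 \<in> I d" "x2 \<in> ?S" "y2 \<in> ?S"
      by (auto simp: set_plus_def)
    moreover have "(x1 + x2) + (y1 + y2) = (x1 + y1) + (x2 + y2)" by simp
    ultimately show "x + y \<in> I d + ?S" using closed by (metis set_plus_intro)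
  next
    fix r x :: "'k poly fract" assume r: "r \<in> span_powers T" and "x \<in> I d + ?S"
    then obtain x1 x2 where "x = x1 + x2" "x1 \<in> I d" "x2 \<in> ?S" by (auto simp: set_plus_def)
    with r show "r * x \<in> I d + ?S" using closed by (simp add: distrib_left set_plus_intro)
  qed
  moreover have "I d \<subseteq> I d + ?S" "?S \<subseteq> I d + ?S"
    using closed set_plus_intro [of _ "I d" 0 ?S] set_plus_intro [of 0 "I d" _ ?S] by auto
  moreover have "I d + ?S \<subseteq> J" if "ideal J R" "I d \<subseteq> J" "?S \<subseteq> J" for J
  proof
    fix x :: "'k poly fract" assume "x \<in> I d + ?S"
    then obtain y z where "x = y + z" "y \<in> I d" "z \<in> ?S" by (auto simp: set_plus_def)
    with that show "x \<in> J" using ideal_closed(3) [OF that(1), of y z] by auto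
  qed
  moreover have "\<forall>d\<in>D. I d \<subseteq> ?S"
    and "\<And>J. ideal J R \<Longrightarrow> \<forall>d\<in>D. I d \<subseteq> J \<Longrightarrow> ?S \<subseteq> J"
    using insert.IH insert.prems by simp_all
  ultimately show ?case unfolding eq
  proof (intro conjI ballI allI impI)
    fix d' assume "\<forall>d\<in>D. I d \<subseteq> ?S" "I d \<subseteq> I d + ?S" "?S \<subseteq> I d + ?S" "d' \<in> insert d D"
    then show "I d' \<subseteq> I d + ?S" by blast
  next
    fix J assume "\<And>J. ideal J R \<Longrightarrow> \<forall>d\<in>D. I d \<subseteq> J \<Longrightarrow> ?S \<subseteq> J"
      and "\<And>J. ideal J R \<Longrightarrow> I d \<subseteq> J \<Longrightarrow> ?S \<subseteq> J \<Longrightarrow> I d + ?S \<subseteq> J"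
      and "ideal J R" "\<forall>d'\<in>insert d D. I d' \<subseteq> J"
    then show "I d + ?S \<subseteq> J" by simp
  qed
qed

text \<open>
  Each close neighbour has some distance \<open>d\<close> with \<open>0 < d < a\<close>, so ideals \<open>I d\<close> containing the
  neighbours at distance \<open>d\<close> add up to everything. The index \<open>i\<close> stands for the distance \<open>i - 1\<close>,
  the one between \<open>F + 1\<close> and \<open>F + i\<close>.
\<close>
lemma sum_of_ideals_eq_near:
  assumes "\<And>d. 0 < d \<Longrightarrow> d < a \<Longrightarrow> ideal (I d) R"
    and "\<And>d. 0 < d \<Longrightarrow> d < a \<Longrightarrow> I d \<subseteq> span_powers near"
    and "\<And>d s. 0 < d \<Longrightarrow> d < a \<Longrightarrow> s \<in> shifts d \<Longrightarrow> t powi s \<in> I d \<and> t powi (s + d) \<in> I d"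
  shows "(\<Sum>i=2..nat a. I (int i - 1)) = span_powers near"
proof -
  let ?S = "\<Sum>i=2..nat a. I (int i - 1)"
  have d: "0 < int i - 1" "int i - 1 < a" if "i \<in> {2..nat a}" for i using that by auto
  have S: "ideal ?S R" "\<And>i. i \<in> {2..nat a} \<Longrightarrow> I (int i - 1) \<subseteq> ?S"
    "\<And>J. ideal J R \<Longrightarrow> (\<And>i. i \<in> {2..nat a} \<Longrightarrow> I (int i - 1) \<subseteq> J) \<Longrightarrow> ?S \<subseteq> J"
    using sum_of_ideals [of "{2..nat a}" "\<lambda>i. I (int i - 1)"] assms(1) [OF d] by auto
  show ?thesis
  proof
    show "?S \<subseteq> span_powers near" by (intro S(3) ideal_near assms(2) d)
    show "span_powers near \<subseteq> ?S"
    proof (rule span_powers_subset_ideal [OF S(1)])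
      fix s assume "s \<in> near"
      have "I d \<subseteq> ?S" if "0 < d" "d < a" for d
        using S(2) [of "nat d + 1"] that by (simp add: nat_add_distrib Suc_le_eq zless_nat_conj)
      moreover obtain d where "0 < d" "d < a" "t powi s \<in> I d"
        using near_shifts [OF \<open>s \<in> near\<close>]
      proof cases
        case (1 d)
        then show ?thesis using that assms(3) by blast
      next
        case (2 d)
        then show ?thesis using that [of d] assms(3) [of d "s - d"] by simp
      qed
      ultimately show "t powi s \<in> ?S" by blast
    qed
  qed
qed

section \<open>Syzygies of the conductor\<close>

lemma finsum_ideal_module:
  assumes "ideal I R" "f \<in> A \<rightarrow> I"
  shows "finsum (ideal_module R I) f A = sum f A"
proof -
  interpret M: Module.module R "ideal_module R I" by (rule module_ideal_module) fact
  show ?thesis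
    using assms(2) by (induction A rule: infinite_finite_induct) (auto simp: Pi_def)
qed

lemma ideal_beyond_F: "ideal (span_powers {F<..}) R"
  by (rule ideal_span_powers) (auto simp: beyond_F dest!: T_nonneg)

abbreviation conductor_module :: "('k poly fract, 'k poly fract) module" where
  "conductor_module \<equiv> ideal_module R (span_powers {F<..})"

end

text \<open>
  The shape of a minimal homogeneous generating system of the conductor: one nonzero multiple
  of each of \<open>t^(F+1), \<dots>, t^(F+a)\<close>, in an arbitrary order recorded by the degrees \<open>e\<close>.
\<close>
locale monomial_conductor_generators = numerical_semigroup_ring T F a R
  for T :: "int set" and F a :: int and R :: "'k::field poly fract ring" +
  fixes gs :: "'k poly fract list" and c :: "nat \<Rightarrow> 'k" and e :: "nat \<Rightarrow> int"
  assumes gs_nth: "i < length gs \<Longrightarrow> gs ! i = mon (c i) (e i)"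
    and c_nonzero: "i < length gs \<Longrightarrow> c i \<noteq> 0"
    and e_bij: "bij_betw e {..<length gs} {F + 1..F + a}"
begin

abbreviation Syz :: "('k poly fract, 'k poly fract vec) module" where
  "Syz \<equiv> syzygy_module R conductor_module gs"

lemma e_range: "i < length gs \<Longrightarrow> F < e i \<and> e i \<le> F + a"
proof -
  assume "i < length gs"
  then have "e i \<in> {F + 1..F + a}" using bij_betwE [OF e_bij] by blast
  then show ?thesis by simp
qed

lemma e_nonneg: "i < length gs \<Longrightarrow> 0 \<le> e i"
  using e_range [of i] T_nonneg beyond_F by blast

lemma e_diff:
  assumes "i < length gs" "j < length gs"
  shows "\<bar>e i - e j\<bar> < a"
  using e_range [OF assms(1)] e_range [OF assms(2)] by linarith

lemma Syz_simps [simp]: "add Syz = (+)" "smult Syz = (\<cdot>\<^sub>v)" "zero Syz = 0\<^sub>v (length gs)"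
  by (simp_all add: syzygy_module_def free_module_def module_vec_simps)

lemma Syz_carrier:
  "v \<in> carrier Syz \<longleftrightarrow> v \<in> carrier_vec (length gs) \<and> (\<forall>i<length gs. v $ i \<in> span_powers T) \<and>
     (\<Sum>i<length gs. v $ i * gs ! i) = 0"
proof -
  have "finsum conductor_module (\<lambda>i. v $ i * gs ! i) {..<length gs} = (\<Sum>i<length gs. v $ i * gs ! i)"
    if "\<forall>i<length gs. v $ i \<in> span_powers T"
  proof (rule finsum_ideal_module [OF ideal_beyond_F])
    show "(\<lambda>i. v $ i * gs ! i) \<in> {..<length gs} \<rightarrow> span_powers {F<..}"
      using that e_range e_nonneg
      by (auto intro!: ideal_closed(4) [OF ideal_beyond_F] simp: gs_nth mon_in_span_powers)
  qed
  then show ?thesis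
    by (auto simp: syzygy_module_def free_module_def)
qed

lemma SyzD:
  assumes "v \<in> carrier Syz"
  shows "v \<in> carrier_vec (length gs)" "dim_vec v = length gs"
    and "i < length gs \<Longrightarrow> v $ i \<in> span_powers T"
    and "(\<Sum>i<length gs. v $ i * gs ! i) = 0"
  using assms by (auto simp: Syz_carrier)

lemma Syz_zero: "0\<^sub>v (length gs) \<in> carrier Syz"
  by (auto simp: Syz_carrier span_powers_0)

lemma Syz_add: "v \<in> carrier Syz \<Longrightarrow> w \<in> carrier Syz \<Longrightarrow> v + w \<in> carrier Syz"
  by (auto simp: Syz_carrier span_powers_add distrib_right sum.distrib)

lemma Syz_smult:
  assumes "r \<in> span_powers T" "v \<in> carrier Syz"
  shows "r \<cdot>\<^sub>v v \<in> carrier Syz"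
proof -
  have "(\<Sum>i<length gs. (r \<cdot>\<^sub>v v) $ i * gs ! i) = r * (\<Sum>i<length gs. v $ i * gs ! i)"
    using SyzD(2) [OF assms(2)] by (simp add: sum_distrib_left mult.assoc)
  then show ?thesis using assms by (auto simp: Syz_carrier mult_in_R)
qed

lemma module_Syz: "Module.module R Syz"
proof (rule module_criteria)
  show "\<forall>v\<in>carrier Syz. \<exists>w\<in>carrier Syz. v \<oplus>\<^bsub>Syz\<^esub> w = \<zero>\<^bsub>Syz\<^esub>"
  proof
    fix v assume v: "v \<in> carrier Syz"
    have "(- 1) \<cdot>\<^sub>v v \<in> carrier Syz" by (intro Syz_smult v span_powers_uminus one_in_R)
    moreover have "v + (- 1) \<cdot>\<^sub>v v = 0\<^sub>v (length gs)" using SyzD(2) [OF v] by (intro eq_vecI) auto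
    ultimately show "\<exists>w\<in>carrier Syz. v \<oplus>\<^bsub>Syz\<^esub> w = \<zero>\<^bsub>Syz\<^esub>" by auto
  qed
qed (auto simp: R.is_cring Syz_zero Syz_add Syz_smult smult_smult_assoc add_smult_distrib_vec
      intro: comm_add_vec assoc_add_vec smult_add_distrib_vec dest!: SyzD(1))

lemma projection_functional:
  assumes "i < length gs"
  shows "(\<lambda>v. v $ i) \<in> functionals Syz"
  using assms by (intro functionalI) (auto dest: SyzD)

text \<open>
  The element of degree \<open>\<gamma>\<close> with coefficients \<open>b\<close> in the free module whose \<open>i\<close>-th basis vector has
  degree \<open>e i\<close>. Integer exponents make it available also for degrees in which some entries leave
  \<open>R\<close>.
\<close>
definition homogeneous_tuple :: "(nat \<Rightarrow> 'k) \<Rightarrow> int \<Rightarrow> 'k poly fract vec" where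
  "homogeneous_tuple b \<gamma> = vec (length gs) (\<lambda>i. mon (b i) (\<gamma> - e i))"

lemma homogeneous_tuple_Syz:
  assumes "\<And>i. i < length gs \<Longrightarrow> b i \<noteq> 0 \<Longrightarrow> \<gamma> - e i \<in> T"
    and "(\<Sum>i<length gs. b i * c i) = 0"
  shows "homogeneous_tuple b \<gamma> \<in> carrier Syz"
proof -
  have "mon (b i) (\<gamma> - e i) \<in> span_powers T" if "i < length gs" for i
    using assms(1) [OF that] by (cases "b i = 0") (auto simp: span_powers_0 mon_in_R)
  moreover have "(\<Sum>i<length gs. mon (b i) (\<gamma> - e i) * gs ! i) = (\<Sum>i<length gs. mon (b i * c i) \<gamma>)"
    by (intro sum.cong) (auto simp: gs_nth mon_mult)
  ultimately show ?thesis
    using assms(2) by (auto simp: Syz_carrier homogeneous_tuple_def sum_mon)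
qed

text \<open>
  If \<open>t^s\<close> occurs in the value, some exponent \<open>\<gamma> - e i\<close> of the syzygy is at most \<open>s\<close>: otherwise
  shifting its degree by \<open>F - s\<close> moves all exponents above \<open>F\<close>, which gives a syzygy and
  contradicts the gap. A second exponent \<open>\<gamma> - e j\<close> exists because one nonzero term cannot cancel,
  and its distance from the first is less than \<open>a\<close>. The two are transported to \<open>s\<close>.
\<close>
lemma functional_on_homogeneous_tuple:
  assumes f: "f \<in> functionals Syz"
    and b: "\<And>i. i < length gs \<Longrightarrow> b i \<noteq> 0 \<Longrightarrow> \<gamma> - e i \<in> T"
    and sum: "(\<Sum>i<length gs. b i * c i) = 0"
  shows "f (homogeneous_tuple b \<gamma>) \<in> span_powers near"
proof -
  let ?h = "homogeneous_tuple b \<gamma>"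
  have h: "?h \<in> carrier Syz" using b sum by (rule homogeneous_tuple_Syz)
  have "s \<in> near" if nz: "coeff_at (f ?h) s \<noteq> 0" for s
  proof -
    have s: "s \<in> T" using functionalD(1) [OF f h] nz by (rule span_powersD)
    have "\<exists>i<length gs. b i \<noteq> 0 \<and> \<gamma> - e i \<le> s"
    proof (rule ccontr)
      assume "\<not> ?thesis"
      then have above: "s < \<gamma> - e i" if "i < length gs" "b i \<noteq> 0" for i
        using that by force
      let ?z = "homogeneous_tuple b (\<gamma> + (F - s))"
      have "?z \<in> carrier Syz"
      proof (rule homogeneous_tuple_Syz [OF _ sum])
        fix i assume "i < length gs" "b i \<noteq> 0"
        from above [OF this] show "\<gamma> + (F - s) - e i \<in> T" by (intro beyond_F) simp
      qed
      moreover define N where "N = \<bar>F\<bar> + \<bar>s\<bar> + 1"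
      moreover have "N \<in> T" "N + (F - s) \<in> T" by (auto simp: N_def intro!: beyond_F)
      moreover have "mon 1 N \<odot>\<^bsub>Syz\<^esub> ?z = mon 1 (N + (F - s)) \<odot>\<^bsub>Syz\<^esub> ?h"
        by (auto simp: homogeneous_tuple_def mon_mult algebra_simps)
      ultimately show False using Frobenius_obstruction [OF f h] nz by blast
    qed
    then obtain i where i: "i < length gs" "b i \<noteq> 0" "\<gamma> - e i \<le> s" by blast
    have "\<exists>j<length gs. j \<noteq> i \<and> b j \<noteq> 0"
    proof (rule ccontr)
      assume "\<not> ?thesis"
      then have "(\<Sum>j\<in>{..<length gs} - {i}. b j * c j) = 0" by (intro sum.neutral) auto
      then have "(\<Sum>j<length gs. b j * c j) = b i * c i"
        using i by (subst sum.remove [of _ i]) auto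
      then show False using sum i c_nonzero by simp
    qed
    then obtain j where j: "j < length gs" "j \<noteq> i" "b j \<noteq> 0" by blast
    have "e i \<noteq> e j" using e_bij i j by (metis bij_betw_def inj_onD lessThan_iff)
    with i j s show ?thesis
      using near_transport [of "\<gamma> - e i" "\<gamma> - e j" s] b e_diff [of i j] by auto
  qed
  then show ?thesis using functionalD(1) [OF f h] by (simp add: span_powers_def)
qed

text \<open>
  A syzygy is the sum of its homogeneous components, which are syzygies because the generators
  are monomials. The induction removes one component at a time; \<open>G\<close> bounds the set of degrees
  that are left.
\<close>
lemma functional_on_Syz:
  assumes f: "f \<in> functionals Syz" and "finite G" and "v \<in> carrier Syz"
    and "\<And>i \<gamma>. i < length gs \<Longrightarrow> coeff_at (v $ i) (\<gamma> - e i) \<noteq> 0 \<Longrightarrow> \<gamma> \<in> G"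
  shows "f v \<in> span_powers near"
  using assms(2-)
proof (induction G arbitrary: v rule: finite_induct)
  case (empty v)
  have "v $ i = 0" if "i < length gs" for i
  proof (rule coeff_at_eqI)
    show "coeff_at (v $ i) j = coeff_at 0 j" for j
      using empty.prems(2) [OF that, of "j + e i"] by auto
  qed (use SyzD(3) [OF empty.prems(1) that] in \<open>auto simp: polys_0 dest: span_powers_polys\<close>)
  then have "v = 0 \<cdot>\<^sub>v v" using SyzD(2) [OF empty.prems(1)] by (intro eq_vecI) auto
  then have "f v = 0 * f v"
    using functionalD(3) [OF f span_powers_0 empty.prems(1)] by simp
  then show ?case by (simp add: span_powers_0)
next
  case (insert \<gamma> G v)
  note v = SyzD [OF insert.prems(1)]
  define b where "b i = coeff_at (v $ i) (\<gamma> - e i)" for i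
  have b: "\<gamma> - e i \<in> T" if "i < length gs" "b i \<noteq> 0" for i
    using that span_powersD [OF v(3)] by (auto simp: b_def)
  have P: "v $ i \<in> polys" if "i < length gs" for i using v(3) [OF that] by (rule span_powers_polys)
  have "(\<Sum>i<length gs. b i * c i) = (\<Sum>i<length gs. coeff_at (v $ i * gs ! i) \<gamma>)"
    using P e_nonneg by (intro sum.cong refl)
      (simp add: gs_nth b_def coeff_at_mon_mult_nonneg mult.commute [of _ "mon _ _"])
  also have "\<dots> = coeff_at (\<Sum>i<length gs. v $ i * gs ! i) \<gamma>"
    using P e_nonneg by (subst coeff_at_sum) (auto simp: gs_nth intro!: polys_mult mon_polys)
  finally have sum: "(\<Sum>i<length gs. b i * c i) = 0" by (simp add: v(4))
  define h where "h = homogeneous_tuple b \<gamma>"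
  have h: "h \<in> carrier Syz" unfolding h_def using b sum by (rule homogeneous_tuple_Syz)
  have fh: "f h \<in> span_powers near"
    unfolding h_def using f b sum by (rule functional_on_homogeneous_tuple)
  define w where "w = v + (- 1) \<cdot>\<^sub>v h"
  have w: "w \<in> carrier Syz"
    unfolding w_def by (intro Syz_add Syz_smult insert.prems(1) h span_powers_uminus one_in_R)
  have "f w \<in> span_powers near"
  proof (rule insert.IH [OF w])
    fix i \<delta> assume i: "i < length gs" and nz: "coeff_at (w $ i) (\<delta> - e i) \<noteq> 0"
    have hi: "h $ i = mon (b i) (\<gamma> - e i)" using i by (simp add: h_def homogeneous_tuple_def)
    have "w $ i = v $ i - h $ i" using i SyzD(2) [OF h] by (simp add: w_def)
    then have "coeff_at (w $ i) (\<delta> - e i) = coeff_at (v $ i) (\<delta> - e i) - coeff_at (h $ i) (\<delta> - e i)"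
      using P [OF i] span_powers_polys [OF SyzD(3) [OF h i]]
      by (simp add: coeff_at_diff)
    also have "coeff_at (h $ i) (\<delta> - e i) = (if \<delta> = \<gamma> then b i else 0)"
      using b [OF i] T_nonneg [of "\<gamma> - e i"] by (cases "b i = 0") (auto simp: hi coeff_at_mon)
    finally show "\<delta> \<in> G"
      using nz insert.prems(2) [OF i, of \<delta>] by (auto simp: b_def split: if_splits)
  qed
  moreover have "v = w + h" using v(2) SyzD(2) [OF h] by (intro eq_vecI) (auto simp: w_def)
  then have "f v = f w + f h" using functionalD(2) [OF f w h] by simp
  ultimately show ?case using fh by (simp add: span_powers_add)
qed

lemma functional_value_near:
  assumes f: "f \<in> functionals Syz" and v: "v \<in> carrier Syz"
  shows "f v \<in> span_powers near"
proof (rule functional_on_Syz [OF f _ v])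
  let ?G = "\<Union>i<length gs. (\<lambda>j. j + e i) ` {j. coeff_at (v $ i) j \<noteq> 0}"
  show "finite ?G" by (auto intro: finite_support)
  fix i \<gamma> assume "i < length gs" "coeff_at (v $ i) (\<gamma> - e i) \<noteq> 0"
  then show "\<gamma> \<in> ?G" by (auto intro!: bexI [of _ i] image_eqI [of _ _ "\<gamma> - e i"])
qed

text \<open>
  If \<open>s\<close> and \<open>s'\<close> are neighbours, two generators with \<open>e i - e j = s' - s\<close> exist, and the relation
  between them has the entries \<open>t^s\<close> and a multiple of \<open>t^s'\<close>.
\<close>
lemma near_entry:
  assumes "s \<in> near"
  obtains v i where "v \<in> carrier Syz" "i < length gs" "v $ i = t powi s"
proof -
  obtain s' where s': "s \<in> T" "s' \<in> T" "s' \<noteq> s" "\<bar>s' - s\<bar> < a"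
    using assms by (auto simp: near_def)
  \<comment> \<open>The least degree \<open>m\<close> of a generator for which \<open>m + s - s'\<close> is one too.\<close>
  define m where "m = max (F + 1) (F + 1 + s' - s)"
  have "m \<in> {F + 1..F + a}" "m + s - s' \<in> {F + 1..F + a}"
    using s' by (auto simp: m_def max_def)
  then obtain i j where ij: "i < length gs" "j < length gs" "e i = m" "e j = m + s - s'"
    using e_bij by (metis bij_betw_imp_surj_on imageE lessThan_iff)
  then have "i \<noteq> j" using s' by auto
  define b where "b = (\<lambda>_. 0 :: 'k)(i := 1, j := - (c i / c j))"
  have "(\<Sum>k<length gs. b k * c k) = b i * c i + (b j * c j + (\<Sum>k\<in>{..<length gs} - {i} - {j}. b k * c k))"
    using ij \<open>i \<noteq> j\<close> by (subst sum.remove [of _ i], simp, simp, subst sum.remove [of _ j]) auto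
  also have "\<dots> = 0" using \<open>i \<noteq> j\<close> c_nonzero [OF ij(2)] by (simp add: b_def)
  finally have "homogeneous_tuple b (s + e i) \<in> carrier Syz"
    using s' ij by (intro homogeneous_tuple_Syz) (auto simp: b_def split: if_splits)
  moreover have "homogeneous_tuple b (s + e i) $ i = t powi s"
    using ij \<open>i \<noteq> j\<close> by (simp add: homogeneous_tuple_def b_def mon_one)
  ultimately show thesis using that ij(1) by blast
qed

text \<open>Powers of \<open>t\<close> that are entries of syzygies lie in the trace since projections are linear.\<close>
lemma trace_Syz: "trace_ideal R Syz = span_powers near"
proof
  show "trace_ideal R Syz \<subseteq> span_powers near"
    by (intro trace_ideal_subset ideal_near functional_value_near)
  show "span_powers near \<subseteq> trace_ideal R Syz"
  proof (rule span_powers_subset_ideal [OF ideal_trace_ideal])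
    fix s assume "s \<in> near"
    then obtain v i where "v \<in> carrier Syz" "i < length gs" "v $ i = t powi s" by (rule near_entry)
    then show "t powi s \<in> trace_ideal R Syz"
      using trace_idealI [OF projection_functional] by metis
  qed
qed

text \<open>
  Entries are values of projections, so they are bounded like all linear forms. Conversely the
  syzygies with entries in the entry ideal form a submodule containing the columns, hence all
  syzygies, and the required powers of \<open>t\<close> are entries of syzygies.
\<close>
lemma entry_ideal_eq:
  assumes "dim_row A = length gs" "minimal_generators R Syz (cols A)"
  shows "entry_ideal R A = span_powers near"
proof -
  interpret Syz: Module.module R Syz by (rule module_Syz)
  have cols: "set (cols A) \<subseteq> carrier Syz" and span: "Syz.span (set (cols A)) = carrier Syz"
    using assms(2) by (auto simp: minimal_generators_def)
  have entries: "elements_mat A = {v $ i | v i. v \<in> set (cols A) \<and> i < length gs}"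
  proof -
    have "elements_mat A = {A $$ (i, j) | i j. i < length gs \<and> j < dim_col A}"
      using assms(1) by (auto simp: elements_mat_def) blast
    also have "\<dots> = {v $ i | v i. v \<in> set (cols A) \<and> i < length gs}"
    proof (intro equalityI subsetI)
      fix x assume "x \<in> {A $$ (i, j) | i j. i < length gs \<and> j < dim_col A}"
      then obtain i j where "x = col A j $ i" "i < length gs" "j < dim_col A"
        using assms(1) by auto
      moreover from this have "col A j \<in> set (cols A)" by (simp add: cols_def)
      ultimately show "x \<in> {v $ i | v i. v \<in> set (cols A) \<and> i < length gs}" by blast
    next
      fix x assume "x \<in> {v $ i | v i. v \<in> set (cols A) \<and> i < length gs}"
      then obtain i j where "x = col A j $ i" "i < length gs" "j < dim_col A"
        by (auto simp: cols_def)
      with assms(1) have "x = A $$ (i, j)" by simp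
      with \<open>i < length gs\<close> \<open>j < dim_col A\<close>
      show "x \<in> {A $$ (i, j) | i j. i < length gs \<and> j < dim_col A}" by blast
    qed
    finally show ?thesis .
  qed
  have near: "elements_mat A \<subseteq> span_powers near"
    using functional_value_near [OF projection_functional] cols by (auto simp: entries)
  then have "elements_mat A \<subseteq> carrier R" using span_powers_mono [OF near_subset_T] by auto
  note I = R.genideal_ideal [OF this] and mem = R.genideal_self [OF this]
  have "submodule R {v \<in> carrier Syz. \<forall>i<length gs. v $ i \<in> Idl\<^bsub>R\<^esub> elements_mat A} Syz"
    using ideal_closed [OF I]
    by (intro submodule.intro module_Syz) (auto simp: Syz_zero Syz_add Syz_smult dest: SyzD(2))
  moreover have "set (cols A) \<subseteq> {v \<in> carrier Syz. \<forall>i<length gs. v $ i \<in> Idl\<^bsub>R\<^esub> elements_mat A}"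
    using cols mem by (auto simp: entries)
  ultimately have "Syz.span (set (cols A)) \<subseteq> {v \<in> carrier Syz. \<forall>i<length gs. v $ i \<in> Idl\<^bsub>R\<^esub> elements_mat A}"
    by (intro Syz.span_is_subset)
  then have all: "v $ i \<in> Idl\<^bsub>R\<^esub> elements_mat A" if "v \<in> carrier Syz" "i < length gs" for v i
    using that unfolding span by blast
  show ?thesis
    unfolding entry_ideal_def
  proof
    show "Idl\<^bsub>R\<^esub> elements_mat A \<subseteq> span_powers near"
      using near by (rule R.genideal_minimal [OF ideal_near])
    show "span_powers near \<subseteq> Idl\<^bsub>R\<^esub> elements_mat A"
    proof (rule span_powers_subset_ideal [OF I])
      fix s assume "s \<in> near"
      then obtain v i where "v \<in> carrier Syz" "i < length gs" "v $ i = t powi s" by (rule near_entry)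
      with all show "t powi s \<in> Idl\<^bsub>R\<^esub> elements_mat A" by metis
    qed
  qed
qed

end

section \<open>The conductor of a numerical semigroup ring\<close>

text \<open>
  The polynomial ring \<open>k[t]\<close> is integrally closed. Write \<open>x = u / w\<close> with \<open>w\<close> of least degree. The
  generator \<open>g\<close> of the ideal \<open>(u, w)\<close> is then constant, since it could be cancelled. Clearing
  denominators in the equation for \<open>x\<close> shows that \<open>w\<close> divides a power of \<open>u\<close>, and being comaximal
  with \<open>u\<close> it is a unit.
\<close>
lemma integral_over_polys:
  fixes x :: "'k::field poly fract"
  assumes "lead_coeff p = 1" "\<And>i. poly.coeff p i \<in> polys" "poly p x = 0"
  shows "x \<in> polys"
proof -
  let ?P = "\<lambda>w. w \<noteq> 0 \<and> (\<exists>u. x * to_fract w = to_fract u)"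
  obtain u0 w0 where "x = Fract u0 w0" "w0 \<noteq> 0" by (cases x) auto
  then have "?P w0" by (auto simp: Fract_conv_to_fract)
  then obtain w where w: "?P w" and w_least: "\<And>v. ?P v \<Longrightarrow> Polynomial.degree w \<le> Polynomial.degree v"
    using ex_has_least_nat [of ?P w0 Polynomial.degree] by blast
  then obtain u where u: "x * to_fract w = to_fract u" by blast
  let ?L = "\<lambda>g. g \<noteq> 0 \<and> (\<exists>\<alpha> \<beta>. g = \<alpha> * u + \<beta> * w)"
  have "?L w" using w by (auto intro: exI [of _ 0] exI [of _ 1])
  then obtain g where g: "?L g" and g_least: "\<And>h. ?L h \<Longrightarrow> Polynomial.degree g \<le> Polynomial.degree h"
    using ex_has_least_nat [of ?L w Polynomial.degree] by blast
  then obtain \<alpha> \<beta> where bezout: "g = \<alpha> * u + \<beta> * w" by blast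
  have g_dvd: "g dvd h" if "h = \<alpha>' * u + \<beta>' * w" for h \<alpha>' \<beta>'
  proof (rule ccontr)
    assume "\<not> g dvd h"
    then have nz: "h mod g \<noteq> 0" by (simp add: dvd_eq_mod_eq_0)
    have "h mod g = h - (h div g) * g" by (simp add: minus_div_mult_eq_mod)
    also have "\<dots> = (\<alpha>' - h div g * \<alpha>) * u + (\<beta>' - h div g * \<beta>) * w"
      unfolding bezout that by (simp add: algebra_simps)
    finally have "Polynomial.degree g \<le> Polynomial.degree (h mod g)" using nz g_least by blast
    then show False using degree_mod_less [of g h] g nz by simp
  qed
  obtain u' where u': "u = g * u'" using g_dvd [of u 1 0] by auto
  obtain w' where w': "w = g * w'" using g_dvd [of w 0 1] by auto
  have "w' \<noteq> 0" using w w' by auto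
  moreover have "x * to_fract w' = to_fract u'" using u g by (simp add: u' w')
  ultimately have "Polynomial.degree w \<le> Polynomial.degree w'" using w_least by blast
  then have "Polynomial.degree g = 0" using g \<open>w' \<noteq> 0\<close> by (simp add: w' degree_mult_eq)
  then obtain d where d: "g = [:d:]" "d \<noteq> 0" using g by (metis degree_eq_zeroE pCons_0_0)
  then have one: "1 = [:inverse d:] * \<alpha> * u + [:inverse d:] * \<beta> * w"
  proof -
    have "1 = [:inverse d:] * g" using d by (simp add: one_pCons)
    then show ?thesis by (simp only: bezout distrib_left mult.assoc)
  qed
  define n where "n = Polynomial.degree p"
  have "\<exists>q. poly.coeff p i = to_fract q" for i using assms(2) [of i] by (auto elim: polysE)
  then obtain q where q: "\<And>i. poly.coeff p i = to_fract (q i)" by metis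
  have "to_fract (q n) = to_fract 1" using assms(1) by (simp add: n_def flip: q)
  then have "q n = 1" by (simp only: to_fract_eq_iff)
  have "to_fract (\<Sum>i\<le>n. q i * u ^ i * w ^ (n - i)) = (\<Sum>i\<le>n. poly.coeff p i * x ^ i * to_fract w ^ n)"
  proof -
    have "to_fract (q i * u ^ i * w ^ (n - i)) = poly.coeff p i * x ^ i * to_fract w ^ n" if "i \<le> n" for i
    proof -
      have "to_fract w ^ n = to_fract w ^ i * to_fract w ^ (n - i)"
        using that by (simp flip: power_add)
      then show ?thesis
        by (simp add: q to_fract_power power_mult_distrib flip: u)
    qed
    then show ?thesis by (simp del: to_fract_mult)
  qed
  also have "\<dots> = poly p x * to_fract w ^ n"
    by (simp add: poly_altdef n_def sum_distrib_right)
  also have "\<dots> = 0" by (simp add: assms(3))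
  finally have "(\<Sum>i\<le>n. q i * u ^ i * w ^ (n - i)) = 0" by (simp only: to_fract_eq_0_iff)
  then have "u ^ n + (\<Sum>i<n. q i * u ^ i * w ^ (n - i)) = 0"
    using \<open>q n = 1\<close> by (simp add: lessThan_Suc_atMost [symmetric] add.commute)
  moreover have "w dvd (\<Sum>i<n. q i * u ^ i * w ^ (n - i))"
    by (intro dvd_sum dvd_mult dvd_power) simp
  ultimately have "w dvd u ^ n" by (simp add: eq_neg_iff_add_eq_0 [symmetric])
  then have "w dvd 1"
  proof (induction n)
    \<comment> \<open>The Bezout identity lowers the power of \<open>u\<close> that \<open>w\<close> divides.\<close>
    case (Suc n)
    have "u ^ n = u ^ n * ([:inverse d:] * \<alpha> * u + [:inverse d:] * \<beta> * w)"
      unfolding one [symmetric] by simp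
    also have "\<dots> = [:inverse d:] * \<alpha> * u ^ Suc n + (u ^ n * [:inverse d:] * \<beta>) * w"
      by (simp only: power_Suc distrib_left mult.assoc mult.left_commute mult.commute)
    finally have "w dvd u ^ n" using Suc.prems by (metis dvd_add dvd_mult dvd_triv_right)
    then show ?case by (rule Suc.IH)
  qed simp
  then obtain v where "1 = w * v" by auto
  then have "x = x * to_fract w * to_fract v" by (metis mult.assoc mult.right_neutral to_fract_1 to_fract_mult)
  then show ?thesis unfolding polys_def by (metis u to_fract_mult rangeI)
qed

context numerical_semigroup_ring
begin

lemma t_powi_in_R_iff: "(t powi i :: 'k poly fract) \<in> span_powers T \<longleftrightarrow> i \<in> T"
  using mon_in_R [of i 1] mon_in_span_powersD(1) [of "1 :: 'k" i T] by (auto simp: mon_one)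

text \<open>Multiplying numerator and denominator by \<open>t^m\<close> with \<open>m > F\<close> moves both into \<open>R\<close>.\<close>
lemma quotient_field_R: "quotient_field R = UNIV"
proof -
  have "x \<in> quotient_field R" for x
  proof -
    obtain u w where x: "x = Fract u w" "w \<noteq> 0" by (cases x) auto
    define m where "m = \<bar>F\<bar> + 1"
    have "t powi m * to_fract v \<in> span_powers T" for v :: "'k poly"
    proof -
      have "t powi m * to_fract v \<in> span_powers {F<..}"
        unfolding mon_one [symmetric]
      proof (rule span_powers_mult)
        show "mon 1 m \<in> span_powers {m}" by (simp add: mon_in_span_powers m_def)
        show "to_fract v \<in> span_powers {0..}"
          by (auto simp: span_powers_def polys_def dest: coeff_at_nonneg)
      qed (auto simp: m_def)
      then show ?thesis using span_powers_mono [of "{F<..}" T] beyond_F by auto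
    qed
    moreover have "x = (t powi m * to_fract u) / (t powi m * to_fract w)"
      using x by (simp add: Fract_conv_to_fract)
    moreover have "t powi m * to_fract w \<noteq> 0" using x(2) by simp
    ultimately show ?thesis unfolding quotient_field_def R_simps by blast
  qed
  then show ?thesis by auto
qed

text \<open>The power \<open>t^j\<close> is a root of \<open>X^N - t^(j N)\<close>, whose constant term is in \<open>R\<close> for \<open>N > F\<close>.\<close>
lemma t_power_integral: "0 \<le> j \<Longrightarrow> t powi j \<in> integral_closure R"
proof -
  assume "0 \<le> j"
  define N where "N = nat (\<bar>F\<bar> + 1)"
  have "0 < N" by (simp add: N_def)
  let ?p = "Polynomial.monom 1 N + [:- ((t :: 'k poly fract) powi (j * int N)):]"
  have "j * int N \<in> T"
  proof (cases "j = 0")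
    case False
    have "F < int N" by (simp add: N_def)
    also have "int N \<le> j * int N" using False \<open>0 \<le> j\<close> mult_right_mono [of 1 j "int N"] by simp
    finally show ?thesis by (rule beyond_F)
  qed (simp add: zero_in_T)
  then have T: "(t :: 'k poly fract) powi (j * int N) \<in> span_powers T" by (simp add: t_powi_in_R_iff)
  have "Polynomial.degree ?p = N"
    using \<open>0 < N\<close> by (subst degree_add_eq_left) (simp_all add: degree_monom_eq)
  then have "lead_coeff ?p = 1" using \<open>0 < N\<close> by (simp add: coeff_pCons split: nat.split)
  moreover have "poly.coeff ?p i \<in> span_powers T" for i
    using T by (auto simp: coeff_pCons span_powers_0 one_in_R span_powers_uminus span_powers_add
        split: nat.split intro: span_powers_uminus)
  moreover have "poly ?p (t powi j) = 0" by (simp add: poly_monom power_int_mult)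
  ultimately show ?thesis
    unfolding integral_closure_def quotient_field_R R_simps by blast
qed

text \<open>
  An exponent \<open>s \<le> F\<close> of an element \<open>x\<close> of the conductor is impossible because \<open>x t^(F-s)\<close> would be
  an element of \<open>R\<close> involving \<open>t^F\<close>. For the converse, only the elements integral over \<open>R\<close> have to
  be multiplied into \<open>R\<close>, and they are polynomials.
\<close>
lemma conductor_R: "conductor R = span_powers {F<..}"
proof
  show "conductor R \<subseteq> span_powers {F<..}"
  proof
    fix x assume "x \<in> conductor R"
    then have mult: "x * t powi j \<in> span_powers T" if "0 \<le> j" for j
      using t_power_integral [OF that] by (simp add: conductor_def)
    have x: "x \<in> polys" using span_powers_polys [OF mult [of 0]] by simp
    have "F < s" if "coeff_at x s \<noteq> 0" for s
    proof (rule ccontr)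
      assume "\<not> F < s"
      then have "mon 1 (F - s) * x \<in> span_powers T"
        using mult [of "F - s"] by (simp add: mon_one mult.commute)
      moreover have "coeff_at (mon 1 (F - s) * x) F = coeff_at x s"
        using x \<open>\<not> F < s\<close> by (simp add: coeff_at_mon_mult_nonneg)
      ultimately show False using that F_notin_T span_powersD by metis
    qed
    with x show "x \<in> span_powers {F<..}" by (auto simp: span_powers_def)
  qed
  show "span_powers {F<..} \<subseteq> conductor R"
  proof
    fix x :: "'k poly fract" assume x: "x \<in> span_powers {F<..}"
    have "x * y \<in> span_powers T" if "y \<in> integral_closure R" for y
    proof -
      have "y \<in> polys"
        using that integral_over_polys span_powers_polys by (fastforce simp: integral_closure_def)
      then have "y \<in> span_powers {0..}" by (auto simp: span_powers_def dest: coeff_at_nonneg)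
      then show ?thesis by (rule span_powers_mult [OF x]) (auto intro: beyond_F)
    qed
    then show "x \<in> conductor R" by (simp add: conductor_def quotient_field_R)
  qed
qed

text \<open>Every degree above \<open>F\<close> is one of \<open>F + 1, \<dots>, F + a\<close> plus a multiple of \<open>a\<close>.\<close>
lemma span_conductor_generators:
  assumes "\<And>j. j \<in> {F + 1..F + a} \<Longrightarrow> \<exists>c. c \<noteq> 0 \<and> mon c j \<in> G" and "G \<subseteq> span_powers {F<..}"
  shows "LinearCombinations.module.span R conductor_module G = span_powers {F<..}"
proof -
  interpret C: Module.module R conductor_module by (rule module_ideal_module [OF ideal_beyond_F])
  have sub: "submodule R (C.span G) conductor_module"
    using assms(2) by (intro C.span_is_submodule) simp
  show ?thesis
  proof
    show "C.span G \<subseteq> span_powers {F<..}" using C.span_is_subset2 [of G] assms(2) by simp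
    show "span_powers {F<..} \<subseteq> C.span G"
    proof (rule span_powers_subset)
      show "0 \<in> C.span G" using submodule.zero_closed [OF sub] by simp
      show "y + z \<in> C.span G" if "y \<in> C.span G" "z \<in> C.span G" for y z
        using submodule.m_closed [OF sub that] by simp
      fix c i assume "i \<in> {F<..}"
      define r where "r = (i - F - 1) mod a"
      define k where "k = (i - F - 1) div a"
      have "0 \<le> r" "r < a" using a_pos by (simp_all add: r_def)
      moreover have "0 \<le> k" using \<open>i \<in> {F<..}\<close> a_pos by (simp add: k_def pos_imp_zdiv_nonneg_iff)
      moreover have "i = F + 1 + r + k * a" by (simp add: r_def k_def)
      ultimately obtain d where d: "d \<noteq> 0" "mon d (F + 1 + r) \<in> G"
        using assms(1) [of "F + 1 + r"] by auto
      have "k * a \<in> T" using T_add_mult_a [OF zero_in_T, of "nat k"] \<open>0 \<le> k\<close> by simp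
      then have "mon (c / d) (k * a) * mon d (F + 1 + r) \<in> C.span G"
        using submodule.smult_closed [OF sub, of "mon (c / d) (k * a)" "mon d (F + 1 + r)"]
          C.in_own_span [of G] d assms(2) by (auto simp: mon_in_R)
      then show "mon c i \<in> C.span G"
        using \<open>i = F + 1 + r + k * a\<close> d by (simp add: mon_mult add.commute)
    qed
  qed
qed

text \<open>
  No \<open>j\<close> among \<open>F + 1, \<dots>, F + a\<close> is the sum of a smaller exponent above \<open>F\<close> and an element of \<open>T\<close>,
  so without a generator of degree \<open>j\<close> the span would miss \<open>t^j\<close>. Choosing one generator in each
  of these degrees already gives a generating set, and by minimality it is the whole system.
\<close>
lemma conductor_generator_degrees:
  assumes gens: "minimal_homogeneous_generators R conductor_module gs ds"
  obtains c e where "monomial_conductor_generators T F a R gs c e"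
proof -
  interpret C: Module.module R conductor_module by (rule module_ideal_module [OF ideal_beyond_F])
  have "distinct gs" and sub: "set gs \<subseteq> span_powers {F<..}"
    and span: "C.span (set gs) = span_powers {F<..}"
    and minimal: "\<And>G. G \<subset> set gs \<Longrightarrow> C.span G \<noteq> span_powers {F<..}"
    and hom: "list_all2 homogeneous gs ds"
    using gens by (auto simp: minimal_homogeneous_generators_def minimal_generators_def)
  have gs_mon: "\<exists>c d. g = mon c d" if "g \<in> set gs" for g
    using that hom by (fastforce simp: list_all2_conv_all_nth in_set_conv_nth homogeneous_def mon_def)
  have "\<exists>c. c \<noteq> 0 \<and> mon c j \<in> set gs" if j: "j \<in> {F + 1..F + a}" for j
  proof (rule ccontr)
    assume none: "\<not> ?thesis"
    \<comment> \<open>Deleting the degree \<open>j\<close> leaves an ideal, since a nonzero step in \<open>T\<close> from above \<open>F\<close> is at least \<open>a\<close>.\<close>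
    let ?A = "{F<..} - {j}"
    have "ideal (span_powers ?A) R"
    proof (rule ideal_span_powers)
      fix i k assume "i \<in> T" "k \<in> ?A"
      then show "i + k \<in> ?A" using T_nonneg [of i] a_least [of i] j by (cases "i = 0") auto
    qed (auto intro: beyond_F)
    then have "submodule R (span_powers ?A) conductor_module"
      using ideal_closed [of "span_powers ?A"] span_powers_mono [of ?A "{F<..}"]
      by (intro submodule.intro C.module_axioms) auto
    moreover have "set gs \<subseteq> span_powers ?A"
    proof
      fix g assume g: "g \<in> set gs"
      then obtain c d where cd: "g = mon c d" using gs_mon by blast
      show "g \<in> span_powers ?A"
      proof (cases "c = 0")
        case False
        then have "F < d" "0 \<le> d" using mon_in_span_powersD [of c d "{F<..}"] g sub cd by auto
        moreover have "d \<noteq> j" using none g cd False by auto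
        ultimately show ?thesis by (simp add: cd mon_in_span_powers)
      qed (simp add: cd span_powers_0)
    qed
    ultimately have "C.span (set gs) \<subseteq> span_powers ?A" by (intro C.span_is_subset)
    then have "(span_powers {F<..} :: 'k poly fract set) \<subseteq> span_powers ?A" unfolding span .
    moreover have "mon (1 :: 'k) j \<in> span_powers {F<..}"
      using j beyond_F [of j] T_nonneg [of j] by (intro mon_in_span_powers) auto
    ultimately show False using mon_in_span_powersD(1) [of "1 :: 'k" j ?A] by auto
  qed
  then obtain u where u: "\<And>j. j \<in> {F + 1..F + a} \<Longrightarrow> u j \<noteq> 0 \<and> mon (u j) j \<in> set gs" by metis
  define g where "g j = mon (u j) j" for j
  have "set gs = g ` {F + 1..F + a}"
  proof (rule ccontr)
    assume "set gs \<noteq> g ` {F + 1..F + a}"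
    then have "g ` {F + 1..F + a} \<subset> set gs" using u by (auto simp: g_def)
    moreover have "C.span (g ` {F + 1..F + a}) = span_powers {F<..}"
    proof (rule span_conductor_generators)
      show "\<exists>c. c \<noteq> 0 \<and> mon c j \<in> g ` {F + 1..F + a}" if "j \<in> {F + 1..F + a}" for j
        using u [OF that] that by (intro exI [of _ "u j"]) (auto simp: g_def)
      show "g ` {F + 1..F + a} \<subseteq> span_powers {F<..}" using u sub by (auto simp: g_def)
    qed
    ultimately show False using minimal by blast
  qed
  moreover have inj: "inj_on g {F + 1..F + a}"
  proof (rule inj_onI)
    fix i j assume ij: "i \<in> {F + 1..F + a}" "j \<in> {F + 1..F + a}" "g i = g j"
    then have "mon (u i) i \<in> span_powers {j}"
      using T_nonneg [OF beyond_F, of j] by (simp add: g_def mon_in_span_powers)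
    then show "i = j" using mon_in_span_powersD(1) [of "u i" i "{j}"] u ij by auto
  qed
  ultimately have "bij_betw g {F + 1..F + a} (set gs)" by (simp add: bij_betw_def)
  define e where "e = (\<lambda>i. inv_into {F + 1..F + a} g (gs ! i))"
  have "bij_betw ((!) gs) {..<length gs} (set gs)"
    using \<open>distinct gs\<close> by (rule bij_betw_nth) simp_all
  then have e: "bij_betw e {..<length gs} {F + 1..F + a}"
    using bij_betw_trans [OF _ bij_betw_inv_into [OF \<open>bij_betw g _ _\<close>], of "(!) gs"]
    by (simp add: e_def comp_def)
  have "gs ! i = g (e i)" if "i < length gs" for i
    using that \<open>set gs = _\<close> by (metis e_def f_inv_into_f nth_mem)
  moreover have "u (e i) \<noteq> 0" if "i < length gs" for i using bij_betwE [OF e] that u by blast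
  ultimately have "monomial_conductor_generators T F a R gs (u \<circ> e) e"
    using e by unfold_locales (simp_all add: g_def)
  then show thesis by (rule that)
qed

end

section \<open>Semigroup rings given by minimal generators\<close>

lemma generators_in_generated_semigroup: "b \<in> B \<Longrightarrow> b \<in> generated_semigroup B"
  unfolding generated_semigroup_def
  by (intro CollectI exI [of _ "{b}"] exI [of _ "\<lambda>_. 1"]) simp

text \<open>Zero contributes nothing to a sum of generators, so a minimal system omits it.\<close>
lemma minimal_semigroup_generators_nonzero:
  assumes "minimal_semigroup_generators B S"
  shows "0 \<notin> B"
proof
  assume "0 \<in> B"
  have "generated_semigroup (B - {0}) = generated_semigroup B"
  proof
    show "generated_semigroup (B - {0}) \<subseteq> generated_semigroup B"
      unfolding generated_semigroup_def by blast
    show "generated_semigroup B \<subseteq> generated_semigroup (B - {0})"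
    proof
      fix s assume "s \<in> generated_semigroup B"
      then obtain C m where C: "finite C" "C \<subseteq> B" and s: "s = (\<Sum>b\<in>C. m b * b)"
        by (auto simp: generated_semigroup_def)
      have "s = (\<Sum>b\<in>C - {0}. m b * b)"
        unfolding s using C(1) by (intro sum.mono_neutral_right) auto
      then show "s \<in> generated_semigroup (B - {0})"
        unfolding generated_semigroup_def using C by (intro CollectI exI [of _ "C - {0}"] exI [of _ m]) auto
    qed
  qed
  moreover have "B - {0} \<subset> B" using \<open>0 \<in> B\<close> by blast
  ultimately show False using assms unfolding minimal_semigroup_generators_def by metis
qed

lemma generated_semigroup_lower_bound:
  assumes "s \<in> generated_semigroup B" "0 < s"
  obtains b where "b \<in> B" "b \<le> s"
proof -
  obtain C m where C: "finite C" "C \<subseteq> B" and s: "s = (\<Sum>b\<in>C. m b * b)"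
    using assms(1) by (auto simp: generated_semigroup_def)
  have "\<exists>b\<in>C. 0 < m b * b"
  proof (rule ccontr)
    assume "\<not> ?thesis"
    then have "s = 0" unfolding s by (intro sum.neutral) auto
    with assms(2) show False by simp
  qed
  then obtain b where b: "b \<in> C" "0 < m b * b" by blast
  then have "b \<le> m b * b" by simp
  also have "\<dots> \<le> s" unfolding s using C b by (intro member_le_sum) auto
  finally show thesis using that b C by blast
qed

text \<open>
  The powers of \<open>t\<close> that are products of generators are those with exponent in the semigroup,
  and with the constants they span a ring.
\<close>
lemma carrier_semigroup_ring:
  assumes zero: "0 \<in> generated_semigroup B"
    and add: "\<And>i j. i \<in> generated_semigroup B \<Longrightarrow> j \<in> generated_semigroup B \<Longrightarrow> i + j \<in> generated_semigroup B"
  shows "carrier (semigroup_ring B) = (span_powers (int ` generated_semigroup B) :: 'k::field poly fract set)"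
proof -
  let ?H = "range const \<union> (\<lambda>b. (t :: 'k poly fract) ^ b) ` B"
  let ?G = "generate_ring class_ring ?H"
  let ?T = "int ` generated_semigroup B"
  have add': "i + j \<in> ?T" if "i \<in> ?T" "j \<in> ?T" for i j
    using that add by (auto simp flip: of_nat_add)
  have mon: "mon c (int b) \<in> (span_powers ?T :: 'k poly fract set)" if "b \<in> generated_semigroup B" for b c
    using that by (intro mon_in_span_powers) auto
  note gen = generate_ring.eng_add [of _ "class_ring :: 'k poly fract ring", simplified]
    generate_ring.eng_mult [of _ "class_ring :: 'k poly fract ring", simplified]
    generate_ring.one [of "class_ring :: 'k poly fract ring", simplified]
    generate_ring.incl [of _ _ "class_ring :: 'k poly fract ring"]
  have "?G \<subseteq> span_powers ?T"
  proof
    fix x assume "x \<in> ?G"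
    then show "x \<in> span_powers ?T"
    proof (induction rule: generate_ring.induct)
      case one
      show ?case using mon [OF zero, of 1] by (simp add: mon_one)
    next
      case (incl h)
      then show ?case
      proof
        assume "h \<in> range const"
        then obtain c where "h = mon c 0" by (auto simp: mon_def)
        then show ?case using mon [OF zero, of c] by simp
      next
        assume "h \<in> (\<lambda>b. t ^ b) ` B"
        then obtain b where "b \<in> B" "h = mon 1 (int b)" by (auto simp: mon_def)
        then show ?case using mon [of b 1] generators_in_generated_semigroup by blast
      qed
    next
      case (a_inv h)
      then show ?case by (simp add: class_ring_simps span_powers_uminus)
    next
      case (eng_add h1 h2)
      then show ?case by (simp add: span_powers_add)
    next
      case (eng_mult h1 h2)
      then show ?case using add' span_powers_mult [of h1 ?T h2 ?T ?T] by simp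
    qed
  qed
  moreover have "span_powers ?T \<subseteq> ?G"
  proof (rule span_powers_subset)
    have "const 0 \<in> ?G" by (intro gen(4)) blast
    then show "0 \<in> ?G" by simp
    show "y + z \<in> ?G" if "y \<in> ?G" "z \<in> ?G" for y z using gen(1) that by blast
    fix c :: 'k and i assume "i \<in> ?T"
    then obtain C m where C: "finite C" "C \<subseteq> B" and i: "i = int (\<Sum>b\<in>C. m b * b)"
      by (auto simp: generated_semigroup_def)
    have pow: "x ^ n \<in> ?G" if "x \<in> ?G" for x n
      by (induction n) (auto intro: gen(2,3) that)
    have "t ^ (\<Sum>b\<in>C. m b * b) \<in> ?G"
      using C
    proof (induction C rule: finite_induct)
      case empty
      show ?case using gen(3) by simp
    next
      case (insert b C)
      have "t ^ b \<in> ?G" using insert.prems by (intro gen(4)) blast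
      then have "(t ^ b) ^ m b \<in> ?G" by (rule pow)
      moreover have "t ^ (\<Sum>b\<in>C. m b * b) \<in> ?G" using insert by blast
      ultimately have "(t ^ b) ^ m b * t ^ (\<Sum>b\<in>C. m b * b) \<in> ?G" by (rule gen(2))
      then show ?case
        using insert.hyps by (simp add: power_add mult.commute [of "m b"] power_mult)
    qed
    moreover have "const c \<in> ?G" by (intro gen(4)) blast
    ultimately have "const c * t ^ (\<Sum>b\<in>C. m b * b) \<in> ?G" using gen(2) by blast
    then show "mon c i \<in> ?G" unfolding i mon_def power_int_of_nat .
  qed
  ultimately show ?thesis by (simp add: semigroup_ring_def)
qed

text \<open>
  The Frobenius number is a supremum in the integers over a set that contains all negative
  numbers; it is attained, as only finitely many natural numbers are gaps. The first generator
  is the least positive element because a nonzero sum of generators is at least one of them.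
\<close>
lemma numerical_semigroup_ring_semigroup_ring:
  fixes R :: "'k::field poly fract ring" and a :: "nat \<Rightarrow> nat"
  assumes S: "numerical_semigroup S" and mono: "strict_mono_on {1..n} a"
    and gens: "minimal_semigroup_generators (a ` {1..n}) S"
    and R: "R = semigroup_ring (a ` {1..n})"
  shows "numerical_semigroup_ring (int ` S) (frobenius_number R) (int (a 1)) R"
proof -
  let ?T = "int ` S"
  have S_eq: "generated_semigroup (a ` {1..n}) = S"
    using gens by (simp add: minimal_semigroup_generators_def)
  have zero: "0 \<in> S" and add: "\<And>x y. x \<in> S \<Longrightarrow> y \<in> S \<Longrightarrow> x + y \<in> S" and fin: "finite (- S)"
    using S by (auto simp: numerical_semigroup_def)
  have carrier: "carrier R = span_powers ?T"
    using carrier_semigroup_ring [of "a ` {1..n}"] zero add unfolding R S_eq by blast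
  have pos: "0 < b" if "b \<in> a ` {1..n}" for b
    using minimal_semigroup_generators_nonzero [OF gens] that by (metis gr0I)
  have "infinite S" using fin finite_Un [of S "- S"] by auto
  then obtain s where "s \<in> S" "0 < s" by (metis finite.simps finite_nat_set_iff_bounded_le le_zero_eq gr0I)
  then obtain b where "b \<in> a ` {1..n}" using generated_semigroup_lower_bound S_eq by metis
  then have n: "1 \<in> {1..n}" by auto
  have a_le: "a 1 \<le> b" if b: "b \<in> a ` {1..n}" for b
  proof -
    obtain x where x: "x \<in> {1..n}" "b = a x" using b by blast
    show ?thesis
    proof (cases "x = 1")
      case False
      with x have "1 < x" by simp
      with strict_mono_onD [OF mono n x(1)] x(2) show ?thesis by simp
    qed (simp add: x)
  qed
  have mem: "t powi i \<notin> carrier R \<longleftrightarrow> i \<notin> ?T" for i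
    using mon_in_span_powers [of i ?T "1 :: 'k"] mon_in_span_powersD(1) [of "1 :: 'k" i ?T]
    by (auto simp: carrier mon_one)
  have F: "frobenius_number R \<notin> ?T \<and> (\<forall>i. i \<notin> ?T \<longrightarrow> i \<le> frobenius_number R)"
  proof -
    let ?M = "Max (insert (- 1) (int ` (- S)))"
    have "?M \<in> insert (- 1) (int ` (- S))" using fin by (intro Max_in) auto
    then have "?M \<notin> ?T" by auto
    moreover have "i \<le> ?M" if "i \<notin> ?T" for i
    proof (cases "i < 0")
      case True
      have "- 1 \<le> ?M" using fin by (intro Max_ge) auto
      with True show ?thesis by simp
    next
      case False
      then have "i = int (nat i)" "nat i \<notin> S" using that by (auto simp: image_iff)
      then have "i \<in> int ` (- S)" by blast
      then show ?thesis using fin by (intro Max_ge) auto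
    qed
    moreover have "frobenius_number R = ?M"
      unfolding frobenius_number_def mem using calculation by (intro cSup_eq_maximum) auto
    ultimately show ?thesis by simp
  qed
  show ?thesis
  proof
    show "R = class_ring\<lparr>carrier := span_powers ?T\<rparr>"
      using carrier by (simp add: R semigroup_ring_def)
    show "int (a 1) \<in> ?T" using n generators_in_generated_semigroup S_eq by blast
    show "0 < int (a 1)" using pos n by simp
    show "int (a 1) \<le> i" if i: "i \<in> ?T" "0 < i" for i
    proof -
      obtain s where s: "i = int s" "s \<in> S" "0 < s" using i by auto
      then obtain b where "b \<in> a ` {1..n}" "b \<le> s" using generated_semigroup_lower_bound S_eq by metis
      then show ?thesis using a_le s by fastforce
    qed
    show "i \<in> ?T" if "frobenius_number R < i" for i using F that by fastforce
    show "i + j \<in> ?T" if "i \<in> ?T" "j \<in> ?T" for i j using that add by (auto simp flip: of_nat_add)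
  qed (use F zero in auto)
qed

section \<open>The trace of the first syzygy of the conductor\<close>

theorem theorem4p5:
  fixes S :: "nat set" and a :: "nat \<Rightarrow> nat" and n :: nat
    and R :: "'k::field poly fract ring" and F :: int
    and C :: "('k poly fract, 'k poly fract) module"
    and A :: "'k poly fract mat"
    and gs :: "'k poly fract list" and ds :: "int list"
  assumes "numerical_semigroup S"
    and "strict_mono_on {1..n} a"
    and "minimal_semigroup_generators (a ` {1..n}) S"
    and "R = semigroup_ring (a ` {1..n})"
    and "F = frobenius_number R"
    and "C = ideal_module R (conductor R)"
    and "minimal_homogeneous_presentation R C A"
    and "minimal_homogeneous_generators R C gs ds"
  shows "trace_ideal R (syzygy_module R C gs) = entry_ideal R A \<and>
    entry_ideal R A =
      (\<Sum>i=2..a 1. trace_ideal R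
        (ideal_module R (Idl\<^bsub>R\<^esub> {t powi (F + 1), t powi (F + int i)}))) \<and>
    (\<Sum>i=2..a 1. trace_ideal R
        (ideal_module R (Idl\<^bsub>R\<^esub> {t powi (F + 1), t powi (F + int i)}))) =
      (\<Sum>i=2..a 1. trace_ideal R
        (ideal_module R (colon R (t powi (F + 1)) (t powi (F + int i)))))"
proof -
  interpret numerical_semigroup_ring "int ` S" F "int (a 1)" R
    unfolding \<open>F = _\<close> using assms(1-4) by (rule numerical_semigroup_ring_semigroup_ring)
  have C: "C = conductor_module" by (simp add: assms(6) conductor_R)
  have "trace_ideal R (syzygy_module R C gs) = span_powers near"
  proof -
    obtain c e where "monomial_conductor_generators (int ` S) F (int (a 1)) R gs c e"
      using conductor_generator_degrees assms(8) unfolding C by blast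
    then interpret monomial_conductor_generators "int ` S" F "int (a 1)" R gs c e .
    show ?thesis unfolding C by (rule trace_Syz)
  qed
  moreover have "entry_ideal R A = span_powers near"
  proof -
    \<comment> \<open>The matrix \<open>A\<close> may belong to a generating system other than \<open>gs\<close>; the span of powers does not
      depend on it.\<close>
    obtain gs' ds' where gs': "minimal_homogeneous_generators R C gs' ds'"
      and A: "dim_row A = length gs'" "minimal_generators R (syzygy_module R C gs') (cols A)"
      using assms(7) by (auto simp: minimal_homogeneous_presentation_def)
    obtain c e where "monomial_conductor_generators (int ` S) F (int (a 1)) R gs' c e"
      using conductor_generator_degrees gs' unfolding C by blast
    then interpret monomial_conductor_generators "int ` S" F "int (a 1)" R gs' c e .
    show ?thesis using A unfolding C by (rule entry_ideal_eq)
  qed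
  moreover have "(\<Sum>i=2..a 1. trace_ideal R
      (ideal_module R (Idl\<^bsub>R\<^esub> {t powi (F + 1), t powi (F + int i)}))) = span_powers near"
  proof -
    have "(\<Sum>i=2..nat (int (a 1)). trace_ideal R
      (ideal_module R (Idl\<^bsub>R\<^esub> {t powi (F + 1), t powi (F + 1 + (int i - 1))}))) = span_powers near"
      by (rule sum_of_ideals_eq_near)
        (auto intro!: ideal_trace_ideal beyond_F trace_two_generated_superset
          dest!: subsetD [OF trace_two_generated_subset, rotated -1])
    then show ?thesis by simp
  qed
  moreover have "(\<Sum>i=2..a 1. trace_ideal R
      (ideal_module R (colon R (t powi (F + 1)) (t powi (F + int i))))) = span_powers near"
  proof -
    have "(\<Sum>i=2..nat (int (a 1)). trace_ideal R (ideal_module R (span_powers (shifts (int i - 1)))))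
        = span_powers near"
      by (rule sum_of_ideals_eq_near [OF ideal_trace_ideal trace_colon_subset])
        (simp_all add: trace_colon_superset)
    moreover have "colon R (t powi (F + 1)) (t powi (F + int i)) = span_powers (shifts (int i - 1))"
      if "i \<in> {2..a 1}" for i
      using that colon_conv [of "F + 1" "int i - 1"] by (simp add: beyond_F)
    ultimately show ?thesis by simp
  qed
  ultimately show ?thesis by simp
qed

end
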